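(* Let $A$ be a point-fibred attractor of an iterated function system $\mathcal{F}=\{\mathbb{X};\,f_1,\dots,f_N\}$ on a complete metric space $(\mathbb{X},d_{\mathbb{X}})$, with fast basin $\widehat{B}\subset\mathbb{X}$. Let $(\mathbb{L},d_{\mathbb{L}})$ be the f-manifold generated by $(\mathcal{F},A)$, where $$d_{\mathbb{L}}(\alpha,\beta)=\min\{d_{\mathbb{X}}(\widehat{\pi}(\alpha),\widehat{\pi}(\iota))+d_{\mathbb{X}}(\widehat{\pi}(\iota),\widehat{\pi}(\beta)):\iota\in p(\alpha,\beta)\},\qquad ( * )$$ and let $\widehat{\pi}:\mathbb{L}\to\mathbb{X}$ and $\widetilde{\pi}:\widehat{\mathbb{I}}\to\mathbb{L}$ be the associated projection maps. The following statements hold. 1. The minimum in $( * )$ is achieved, and $d_{\mathbb{L}}$ is a metric on $\mathbb{L}$. 2. The set of all leaves forms a partition of $\mathbb{L}$, and each leaf is nonempty. 3. The image of $\mathbb{L}$ under $\widehat{\pi}$ is the fast basin, i.e. $\widehat{\pi}(\mathbb{L})=\widehat{B}$. 4. For any $\theta\in\mathbb{I}_-$, the projection $\widehat{\pi}$ maps the sheet $\mathbb{L}_\theta$ isometrically onto the continuation $B_{-\theta}\subseteq\widehat{B}\subseteq\mathbb{X}$: $d_{\mathbb{X}}(\widehat{\pi}(\alpha),\widehat{\pi}(\beta))=d_{\mathbb{L}}(\alpha,\beta)$ for all $\alpha,\beta\in\mathbb{L}_\theta$. 5. Each panicle is homeomorphic to $A$. 6. The projection maps $\widetilde{\pi}:\widehat{\mathbb{I}}\to\mathbb{L}$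 and $\widehat{\pi}:\mathbb{L}\to\widehat{B}$ are continuous; in particular $d_{\mathbb{X}}(\widehat{\pi}(\alpha),\widehat{\pi}(\beta))\leq d_{\mathbb{L}}(\alpha,\beta)$ for all $\alpha,\beta\in\mathbb{L}$. 7. If $A$ is pathwise connected, then $\mathbb{L}$ is pathwise connected. 8. If the metric spaces $(\mathbb{X},d_{\mathbb{X}})$ and $(\mathbb{X},d'_{\mathbb{X}})$ have the same topology, then $(\mathbb{L},d_{\mathbb{L}})$ and $(\mathbb{L},d'_{\mathbb{L}})$ have the same topology, where the metric $d'_{\mathbb{L}}$ is defined by $( * )$ with $d_{\mathbb{X}}$ replaced by $d'_{\mathbb{X}}$. 9. For all $n\in I_-$, both $\sigma_n:\widehat{\mathbb{I}}\to\widehat{\mathbb{I}}$ and $\widetilde{\sigma}_n:\mathbb{L}\to\mathbb{L}$ are continuous and injective, and $$\widetilde{\pi}\circ\sigma_n=\widetilde{\sigma}_n\circ\widetilde{\pi}\ \text{ on }\widehat{\mathbb{I}},\qquad \widehat{\pi}\circ\widetilde{\sigma}_n=f_n\circ\widehat{\pi}\ \text{ on }\mathbb{L}\quad(\text{with } f_n:\widehat{B}\to\widehat{B}).$$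
   Context: An iterated function system (IFS) $\mathcal{F}=\{\mathbb{X};\,f_1,\dots,f_N\}$ is a complete metric space $(\mathbb{X},d_{\mathbb{X}})$ together with finitely many homeomorphisms $f_n:\mathbb{X}\to\mathbb{X}$ of $\mathbb{X}$ onto itself. $H$ is the set of nonempty compact subsets of $\mathbb{X}$ with the Hausdorff metric. For $S\subset\mathbb{X}$, $F(S)=\bigcup_{n=1}^N f_n(S)$, and $F^k$ is the $k$-fold iterate of $F$. An attractor of $\mathcal{F}$ is a set $A\in H$ with $F(A)=A$ for which there is an open set $U\supset A$ such that $F^k(C)\to A$ in the Hausdorff metric for every $C\in H$ with $C\subset U$. The union of all such open sets $U$ is the basin $B(A)$ of $A$. The fast basin of $A$ is $\widehat{B}=\{x\in\mathbb{X}:F^K(\{x\})\cap A\neq\varnothing\text{ for some }K\in\mathbb{N}\}$, $\mathbb{N}=\{1,2,\dots\}$. $I_+=\{1,\dots,N\}$, $I_-=\{-1,\dots,-N\}$, $I=I_+\cup I_-$; $\mathbb{I}_+=I_+^\infty$, $\mathbb{I}_-=I_-^\infty$, $\mathbb{I}=\{\iota\in I^\infty:\iota_i\neq-\iota_{i+1}\text{ for all } i\}$ (infinite words indexed by $\mathbb{N}$), with metric $d_{\mathbb{I}}(\iota,\omega)=\max\{2^{-k}:\iota_k\neq\omega_k\}$ for $\iota\neq\omega$, $0$ otherwise. $S$ is the shift $S(\iota_1\iota_2\cdots)=\iota_2\iota_3\cdots$; $\iota|k=\iota_1\cdots\iota_k$ ($\iota|0=\varnothing$, the empty word); $-\theta$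 is the word with letters $-\theta_k$. Let $$\widehat{\mathbb{I}}=\{\iota\in\mathbb{I}:\exists k\in\mathbb{N},\ \iota_j\in I_-\text{ for }j<k,\ \iota_j\in I_+\text{ for }j\geq k\}.$$ For $n\in I$, $\sigma_n:\mathbb{I}\to\mathbb{I}$ is $\sigma_n(\iota_1\iota_2\cdots)=n\iota_1\iota_2\cdots$ if $\iota_1\neq-n$ and $=\iota_2\iota_3\cdots$ if $\iota_1=-n$; for $n\in I_-$ it maps $\widehat{\mathbb{I}}$ into itself. Set $f_{-n}=f_n^{-1}$ for $n\in I_+$ and $f_{\iota|k}=f_{\iota_1}\circ\cdots\circ f_{\iota_k}$. $A$ is point-fibred if for every $\iota\in\mathbb{I}_+$ the limit $\lim_{k\to\infty}f_{\iota|k}(C)$ exists in the Hausdorff metric for all $C\in H$ with $C\subset B(A)$, is a singleton subset of $A$, and is independent of $C$. The extended coding map $\pi:\widehat{\mathbb{I}}\to\mathbb{X}$ is $\pi(\iota)=\lim_{k\to\infty}f_{\iota|k}(b)$, which exists and is independent of $b\in B(A)$. For $\theta\in\mathbb{I}_+$ the continuation is $B_\theta=A\cup\bigcup_{k\geq1}f_{\theta_1}^{-1}\circ\cdots\circ f_{\theta_k}^{-1}(A)$. Branched fractal manifold. For $\iota\in\widehat{\mathbb{I}}$ let $k_\iota=\min\{k\geq 0:\pi(S^k(\iota))\in A\}$ and $[\iota]=\iota|k_\iota$ (the integer part, a finite, possibly empty, word). Define $\iota\sim\omega$ on $\widehat{\mathbb{I}}$ iff $[\iota]=[\omega]$ and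 $\pi(\iota)=\pi(\omega)$. Let $\mathbb{L}=\widehat{\mathbb{I}}/{\sim}$, and let $\widetilde{\iota}$ be the class of $\iota$. The projection maps are $\widetilde{\pi}:\widehat{\mathbb{I}}\to\mathbb{L}$, $\widetilde{\pi}(\iota)=\widetilde{\iota}$, and $\widehat{\pi}:\mathbb{L}\to\mathbb{X}$, $\widehat{\pi}(\widetilde{\iota})=\pi(\iota)$. For $\alpha=\widetilde{\iota}\in\mathbb{L}$ put $[\alpha]=[\iota]$. For a finite (possibly empty) word $\theta=\theta_1\cdots\theta_m$ in the alphabet $I_-$, the leaf is $l(\theta)=\{\alpha\in\mathbb{L}:[\alpha]=\theta\}$ and the panicle is $p(\theta)=l(\varnothing)\cup l(\theta_1)\cup l(\theta_1\theta_2)\cup\cdots\cup l(\theta)$. For $\theta\in\mathbb{I}_-$ the sheet is $\mathbb{L}_\theta=\bigcup_{k=0}^\infty l(\theta|k)$. For $\alpha,\beta\in\mathbb{L}$, let $K=\max\{k:[\alpha]|k=[\beta]|k\}$, let $[\alpha,\beta]=[\alpha]|K=[\beta]|K$ (the longest common prefix of $[\alpha]$ and $[\beta]$), and let $p(\alpha,\beta)=p([\alpha,\beta])$. The space $\mathbb{L}$ with $d_{\mathbb{L}}$ given by $( * )$ is the f-manifold (branched fractal manifold) generated by $(\mathcal{F},A)$. For $n\in I_-$ the map $\widetilde{\sigma}_n:\mathbb{L}\to\mathbb{L}$, $\widetilde{\sigma}_n(\widetilde{\iota})=\widetilde{\sigma_n(\iota)}$, is well defined.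
   Formalization: In part 2, leaves are claimed nonempty only for the empty word or when A is not a single point, and empty leaves are dropped from the partition: if A is a singleton, every leaf l(θ) with θ nonempty is empty (e.g. f_1(x)=x/2 on the real line, A={0}). *)

theory Defs
  imports "HOL-Analysis.Analysis" "HOL-Library.Sublist"
begin

text \<open>
  An IFS on the complete metric space \<open>'a\<close> is given by \<open>N\<close> and \<open>f\<close>; only the maps
  \<open>f 1, \<dots>, f N\<close> are used.  Letters are integers.  An infinite word
  \<open>\<iota>\<^sub>1\<iota>\<^sub>2\<dots>\<close> is a function \<open>\<iota> :: nat \<Rightarrow> int\<close> whose value at \<open>i\<close> is the letter
  \<open>\<iota>\<^sub>i\<^sub>+\<^sub>1\<close> (positions are shifted by one throughout); finite words are lists.
\<close>

definition IFS :: "nat \<Rightarrow> (nat \<Rightarrow> 'a::complete_space \<Rightarrow> 'a) \<Rightarrow> bool" where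
  "IFS N f \<longleftrightarrow> (\<forall>n\<in>{1..N}. \<exists>g. homeomorphism UNIV UNIV (f n) g)"

definition hutch :: "nat \<Rightarrow> (nat \<Rightarrow> 'a \<Rightarrow> 'a) \<Rightarrow> 'a set \<Rightarrow> 'a set" where
  "hutch N f S = (\<Union>n\<in>{1..N}. f n ` S)"

definition cpts :: "'a::metric_space set set" where
  "cpts = {C. compact C \<and> C \<noteq> {}}"

text \<open>Hausdorff distance, only used on nonempty compact sets.\<close>

definition hausdorff_dist :: "'a::metric_space set \<Rightarrow> 'a set \<Rightarrow> real" where
  "hausdorff_dist S T = max (SUP x\<in>S. infdist x T) (SUP y\<in>T. infdist y S)"

definition hconv :: "(nat \<Rightarrow> 'a::metric_space set) \<Rightarrow> 'a set \<Rightarrow> bool" where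
  "hconv C D \<longleftrightarrow> (\<lambda>k. hausdorff_dist (C k) D) \<longlonglongrightarrow> 0"

definition attracting_nbhd ::
  "nat \<Rightarrow> (nat \<Rightarrow> 'a::metric_space \<Rightarrow> 'a) \<Rightarrow> 'a set \<Rightarrow> 'a set \<Rightarrow> bool" where
  "attracting_nbhd N f A U \<longleftrightarrow> open U \<and> A \<subseteq> U \<and>
     (\<forall>C\<in>cpts. C \<subseteq> U \<longrightarrow> hconv (\<lambda>k. (hutch N f ^^ k) C) A)"

definition attractor :: "nat \<Rightarrow> (nat \<Rightarrow> 'a::metric_space \<Rightarrow> 'a) \<Rightarrow> 'a set \<Rightarrow> bool" where
  "attractor N f A \<longleftrightarrow> A \<in> cpts \<and> hutch N f A = A \<and> (\<exists>U. attracting_nbhd N f A U)"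

definition basin :: "nat \<Rightarrow> (nat \<Rightarrow> 'a::metric_space \<Rightarrow> 'a) \<Rightarrow> 'a set \<Rightarrow> 'a set" where
  "basin N f A = \<Union>{U. attracting_nbhd N f A U}"

definition fast_basin :: "nat \<Rightarrow> (nat \<Rightarrow> 'a \<Rightarrow> 'a) \<Rightarrow> 'a set \<Rightarrow> 'a set" where
  "fast_basin N f A = {x. \<exists>K\<ge>1. (hutch N f ^^ K) {x} \<inter> A \<noteq> {}}"

definition Ipos :: "nat \<Rightarrow> int set" where
  "Ipos N = {1..int N}"

definition Ineg :: "nat \<Rightarrow> int set" where
  "Ineg N = {- int N..-1}"

definition words_pos :: "nat \<Rightarrow> (nat \<Rightarrow> int) set" where
  "words_pos N = {\<iota>. \<forall>i. \<iota> i \<in> Ipos N}"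

definition words_neg :: "nat \<Rightarrow> (nat \<Rightarrow> int) set" where
  "words_neg N = {\<iota>. \<forall>i. \<iota> i \<in> Ineg N}"

definition words :: "nat \<Rightarrow> (nat \<Rightarrow> int) set" where
  "words N = {\<iota>. (\<forall>i. \<iota> i \<in> Ipos N \<union> Ineg N) \<and> (\<forall>i. \<iota> i \<noteq> - \<iota> (Suc i))}"

definition words_hat :: "nat \<Rightarrow> (nat \<Rightarrow> int) set" where
  "words_hat N =
     {\<iota>\<in>words N. \<exists>k. (\<forall>j<k. \<iota> j \<in> Ineg N) \<and> (\<forall>j\<ge>k. \<iota> j \<in> Ipos N)}"

text \<open>The maximum of \<open>2\<^sup>-\<^sup>k\<close> over the (possibly infinite) set of positions where the words
  differ; \<^term>\<open>Max\<close> is only meaningful for finite sets.\<close>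

definition dI :: "(nat \<Rightarrow> int) \<Rightarrow> (nat \<Rightarrow> int) \<Rightarrow> real" where
  "dI \<iota> \<omega> = (if \<iota> = \<omega> then 0 else (GREATEST r. \<exists>k. \<iota> k \<noteq> \<omega> k \<and> r = (1/2) ^ Suc k))"

definition shift :: "nat \<Rightarrow> (nat \<Rightarrow> int) \<Rightarrow> nat \<Rightarrow> int" where
  "shift k \<iota> = (\<lambda>i. \<iota> (i + k))"

definition pre :: "(nat \<Rightarrow> int) \<Rightarrow> nat \<Rightarrow> int list" where
  "pre \<iota> k = map \<iota> [0..<k]"

definition sigma :: "int \<Rightarrow> (nat \<Rightarrow> int) \<Rightarrow> nat \<Rightarrow> int" where
  "sigma n \<iota> = (if \<iota> 0 \<noteq> - n then case_nat n \<iota> else shift 1 \<iota>)"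

definition fx :: "(nat \<Rightarrow> 'a \<Rightarrow> 'a) \<Rightarrow> int \<Rightarrow> 'a \<Rightarrow> 'a" where
  "fx f n = (if n > 0 then f (nat n) else inv (f (nat (- n))))"

definition fword :: "(nat \<Rightarrow> 'a \<Rightarrow> 'a) \<Rightarrow> int list \<Rightarrow> 'a \<Rightarrow> 'a" where
  "fword f w = foldr (\<lambda>n g. fx f n \<circ> g) w id"

definition point_fibred :: "nat \<Rightarrow> (nat \<Rightarrow> 'a::metric_space \<Rightarrow> 'a) \<Rightarrow> 'a set \<Rightarrow> bool" where
  "point_fibred N f A \<longleftrightarrow> (\<forall>\<iota>\<in>words_pos N. \<exists>x\<in>A.
     \<forall>C\<in>cpts. C \<subseteq> basin N f A \<longrightarrow> hconv (\<lambda>k. fword f (pre \<iota> k) ` C) {x})"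

definition coding :: "nat \<Rightarrow> (nat \<Rightarrow> 'a::metric_space \<Rightarrow> 'a) \<Rightarrow> 'a set \<Rightarrow> (nat \<Rightarrow> int) \<Rightarrow> 'a" where
  "coding N f A \<iota> = (THE x. \<forall>b\<in>basin N f A. (\<lambda>k. fword f (pre \<iota> k) b) \<longlonglongrightarrow> x)"

text \<open>For a word \<open>\<theta>\<close> over the positive letters, \<open>f\<^sub>\<theta>\<^sub>1\<^sup>-\<^sup>1 \<circ> \<dots> \<circ> f\<^sub>\<theta>\<^sub>k\<^sup>-\<^sup>1\<close> is
  the map of the negated word.\<close>

definition continuation :: "(nat \<Rightarrow> 'a \<Rightarrow> 'a) \<Rightarrow> 'a set \<Rightarrow> (nat \<Rightarrow> int) \<Rightarrow> 'a set" where
  "continuation f A \<theta> = A \<union> (\<Union>k\<in>{1..}. fword f (map uminus (pre \<theta> k)) ` A)"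

definition int_part ::
  "nat \<Rightarrow> (nat \<Rightarrow> 'a::metric_space \<Rightarrow> 'a) \<Rightarrow> 'a set \<Rightarrow> (nat \<Rightarrow> int) \<Rightarrow> int list" where
  "int_part N f A \<iota> = pre \<iota> (LEAST k. coding N f A (shift k \<iota>) \<in> A)"

definition Lrel ::
  "nat \<Rightarrow> (nat \<Rightarrow> 'a::metric_space \<Rightarrow> 'a) \<Rightarrow> 'a set \<Rightarrow> ((nat \<Rightarrow> int) \<times> (nat \<Rightarrow> int)) set" where
  "Lrel N f A = {(\<iota>, \<omega>). \<iota> \<in> words_hat N \<and> \<omega> \<in> words_hat N \<and>
     int_part N f A \<iota> = int_part N f A \<omega> \<and> coding N f A \<iota> = coding N f A \<omega>}"

definition Lspace ::
  "nat \<Rightarrow> (nat \<Rightarrow> 'a::metric_space \<Rightarrow> 'a) \<Rightarrow> 'a set \<Rightarrow> (nat \<Rightarrow> int) set set" where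
  "Lspace N f A = words_hat N // Lrel N f A"

definition pi_tilde ::
  "nat \<Rightarrow> (nat \<Rightarrow> 'a::metric_space \<Rightarrow> 'a) \<Rightarrow> 'a set \<Rightarrow> (nat \<Rightarrow> int) \<Rightarrow> (nat \<Rightarrow> int) set" where
  "pi_tilde N f A \<iota> = Lrel N f A `` {\<iota>}"

text \<open>Maps induced on classes: the common value of a map on all representatives.\<close>

definition pi_hat ::
  "nat \<Rightarrow> (nat \<Rightarrow> 'a::metric_space \<Rightarrow> 'a) \<Rightarrow> 'a set \<Rightarrow> (nat \<Rightarrow> int) set \<Rightarrow> 'a" where
  "pi_hat N f A \<alpha> = the_elem (coding N f A ` \<alpha>)"

definition Lint ::
  "nat \<Rightarrow> (nat \<Rightarrow> 'a::metric_space \<Rightarrow> 'a) \<Rightarrow> 'a set \<Rightarrow> (nat \<Rightarrow> int) set \<Rightarrow> int list" where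
  "Lint N f A \<alpha> = the_elem (int_part N f A ` \<alpha>)"

definition sigma_tilde ::
  "nat \<Rightarrow> (nat \<Rightarrow> 'a::metric_space \<Rightarrow> 'a) \<Rightarrow> 'a set \<Rightarrow> int \<Rightarrow> (nat \<Rightarrow> int) set \<Rightarrow> (nat \<Rightarrow> int) set" where
  "sigma_tilde N f A n \<alpha> = the_elem ((\<lambda>\<iota>. pi_tilde N f A (sigma n \<iota>)) ` \<alpha>)"

definition leaf ::
  "nat \<Rightarrow> (nat \<Rightarrow> 'a::metric_space \<Rightarrow> 'a) \<Rightarrow> 'a set \<Rightarrow> int list \<Rightarrow> (nat \<Rightarrow> int) set set" where
  "leaf N f A \<theta> = {\<alpha> \<in> Lspace N f A. Lint N f A \<alpha> = \<theta>}"

definition leaves ::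
  "nat \<Rightarrow> (nat \<Rightarrow> 'a::metric_space \<Rightarrow> 'a) \<Rightarrow> 'a set \<Rightarrow> (nat \<Rightarrow> int) set set set" where
  "leaves N f A = leaf N f A ` lists (Ineg N)"

definition panicle ::
  "nat \<Rightarrow> (nat \<Rightarrow> 'a::metric_space \<Rightarrow> 'a) \<Rightarrow> 'a set \<Rightarrow> int list \<Rightarrow> (nat \<Rightarrow> int) set set" where
  "panicle N f A \<theta> = (\<Union>k\<in>{0..length \<theta>}. leaf N f A (take k \<theta>))"

definition sheet ::
  "nat \<Rightarrow> (nat \<Rightarrow> 'a::metric_space \<Rightarrow> 'a) \<Rightarrow> 'a set \<Rightarrow> (nat \<Rightarrow> int) \<Rightarrow> (nat \<Rightarrow> int) set set" where
  "sheet N f A \<theta> = (\<Union>k. leaf N f A (pre \<theta> k))"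

definition panicle2 ::
  "nat \<Rightarrow> (nat \<Rightarrow> 'a::metric_space \<Rightarrow> 'a) \<Rightarrow> 'a set \<Rightarrow>
   (nat \<Rightarrow> int) set \<Rightarrow> (nat \<Rightarrow> int) set \<Rightarrow> (nat \<Rightarrow> int) set set" where
  "panicle2 N f A \<alpha> \<beta> =
     panicle N f A (longest_common_prefix (Lint N f A \<alpha>) (Lint N f A \<beta>))"

text \<open>The distances over which the minimum defining \<open>d\<^sub>L\<close> is taken, for an arbitrary metric \<open>d\<close>
  on \<open>'a\<close>.  That the infimum belongs to this set, i.e. is a minimum, is not part of the
  definition of \<open>dL\<close>.\<close>

definition dL_set ::
  "nat \<Rightarrow> (nat \<Rightarrow> 'a::metric_space \<Rightarrow> 'a) \<Rightarrow> 'a set \<Rightarrow> ('a \<Rightarrow> 'a \<Rightarrow> real) \<Rightarrow>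
   (nat \<Rightarrow> int) set \<Rightarrow> (nat \<Rightarrow> int) set \<Rightarrow> real set" where
  "dL_set N f A d \<alpha> \<beta> =
     (\<lambda>\<gamma>. d (pi_hat N f A \<alpha>) (pi_hat N f A \<gamma>) + d (pi_hat N f A \<gamma>) (pi_hat N f A \<beta>))
       ` panicle2 N f A \<alpha> \<beta>"

definition dL ::
  "nat \<Rightarrow> (nat \<Rightarrow> 'a::metric_space \<Rightarrow> 'a) \<Rightarrow> 'a set \<Rightarrow> ('a \<Rightarrow> 'a \<Rightarrow> real) \<Rightarrow>
   (nat \<Rightarrow> int) set \<Rightarrow> (nat \<Rightarrow> int) set \<Rightarrow> real" where
  "dL N f A d \<alpha> \<beta> = Inf (dL_set N f A d \<alpha> \<beta>)"

definition words_hat_top :: "nat \<Rightarrow> (nat \<Rightarrow> int) topology" where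
  "words_hat_top N = Metric_space.mtopology (words_hat N) dI"

definition Ltop ::
  "nat \<Rightarrow> (nat \<Rightarrow> 'a::metric_space \<Rightarrow> 'a) \<Rightarrow> 'a set \<Rightarrow> ('a \<Rightarrow> 'a \<Rightarrow> real) \<Rightarrow>
   (nat \<Rightarrow> int) set topology" where
  "Ltop N f A d = Metric_space.mtopology (Lspace N f A) (dL N f A d)"

lemma dI_neq:
  assumes "\<iota> \<noteq> \<omega>"
  shows "\<iota> (LEAST k. \<iota> k \<noteq> \<omega> k) \<noteq> \<omega> (LEAST k. \<iota> k \<noteq> \<omega> k)"
    and "dI \<iota> \<omega> = (1/2) ^ Suc (LEAST k. \<iota> k \<noteq> \<omega> k)"
proof -
  let ?m = "LEAST k. \<iota> k \<noteq> \<omega> k"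
  obtain k0 where "\<iota> k0 \<noteq> \<omega> k0" using assms by (auto simp: fun_eq_iff)
  then show m: "\<iota> ?m \<noteq> \<omega> ?m" by (rule LeastI)
  have "(GREATEST r. \<exists>k. \<iota> k \<noteq> \<omega> k \<and> r = (1/2::real) ^ Suc k) = (1/2) ^ Suc ?m"
  proof (rule Greatest_equality)
    show "\<exists>k. \<iota> k \<noteq> \<omega> k \<and> (1/2::real) ^ Suc ?m = (1/2) ^ Suc k"
      using m by (intro exI[of _ ?m] conjI refl)
  next
    fix r :: real assume "\<exists>k. \<iota> k \<noteq> \<omega> k \<and> r = (1/2) ^ Suc k"
    then obtain k where k: "\<iota> k \<noteq> \<omega> k" "r = (1/2) ^ Suc k" by blast
    have "Suc ?m \<le> Suc k" using Least_le[of "\<lambda>k. \<iota> k \<noteq> \<omega> k" k] k(1) by simp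
    then show "r \<le> (1/2) ^ Suc ?m"
      unfolding k(2) by (rule power_decreasing) auto
  qed
  then show "dI \<iota> \<omega> = (1/2) ^ Suc ?m"
    unfolding dI_def if_not_P[OF assms] .
qed

lemma dI_ge:
  assumes "\<iota> k \<noteq> \<omega> k"
  shows "(1/2) ^ Suc k \<le> dI \<iota> \<omega>"
proof -
  have "\<iota> \<noteq> \<omega>" using assms by blast
  moreover have "Suc (LEAST k. \<iota> k \<noteq> \<omega> k) \<le> Suc k"
    using Least_le[of "\<lambda>k. \<iota> k \<noteq> \<omega> k" k] assms by simp
  then have "(1/2::real) ^ Suc k \<le> (1/2) ^ Suc (LEAST k. \<iota> k \<noteq> \<omega> k)"
    by (rule power_decreasing) auto
  ultimately show ?thesis using dI_neq(2) by metis
qed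

lemma Metric_space_dI: "Metric_space M dI"
proof
  fix x y z :: "nat \<Rightarrow> int"
  have pos: "dI x y > 0" if "x \<noteq> y" for x y
    unfolding dI_neq(2)[OF that] by simp
  have z0: "dI x x = 0" for x by (simp add: dI_def)
  have nn: "0 \<le> dI x y" for x y
    using pos[of x y] z0[of x] by (cases "x = y") auto
  show "0 \<le> dI x y" by (rule nn)
  have le: "dI x y \<le> dI y x" for x y
  proof (cases "x = y")
    case False
    show ?thesis unfolding dI_neq(2)[OF False]
      by (rule dI_ge) (rule dI_neq(1)[OF False, THEN not_sym])
  qed simp
  show "dI x y = dI y x" by (intro antisym le)
  show "dI x y = 0 \<longleftrightarrow> x = y" using pos[of x y] z0[of x] by (cases "x = y") auto
  show "dI x z \<le> dI x y + dI y z"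
  proof (cases "x = z")
    case True
    then show ?thesis using nn[of x y] nn[of y z] z0[of x] by simp
  next
    case False
    let ?m = "LEAST k. x k \<noteq> z k"
    have "x ?m \<noteq> y ?m \<or> y ?m \<noteq> z ?m" using dI_neq(1)[OF False] by argo
    then have "(1/2) ^ Suc ?m \<le> dI x y \<or> (1/2) ^ Suc ?m \<le> dI y z"
      using dI_ge by blast
    then show ?thesis unfolding dI_neq(2)[OF False]
      using nn[of x y] nn[of y z] by linarith
  qed
qed

end

theory Submission
  imports Defs
begin

text \<open>
  Write \<open>K \<theta> = f\<^sub>\<theta>(A)\<close>.  For negative words these compact sets increase along prefixes, and a class
  \<open>\<alpha>\<close> is determined by its integer part and its image \<open>x\<close> under \<open>\<pi>\<close>, the integer part being the
  shortest prefix \<open>\<theta>\<close> of itself with \<open>x \<in> K \<theta>\<close>.  Hence \<open>\<pi>\<close> maps the panicle of \<open>\<theta>\<close> bijectively onto \<open>K \<theta>\<close>,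
  and \<open>d\<^sub>L(\<alpha>, \<beta>)\<close> is the length of a shortest detour from \<open>\<pi>(\<alpha>)\<close> to \<open>\<pi>(\<beta>)\<close> through the compact set \<open>K\<close> of
  the longest common prefix; it is the distance in \<open>X\<close> as soon as one integer part extends the other.
  The triangle inequality holds because, among the common prefixes of the three pairs in a triple, the
  shorter of any two is a prefix of the third.  The maps induced by the letters act on pairs \<open>(\<theta>, x)\<close> by
  \<open>(\<theta>, x) \<mapsto> (n\<theta>, f\<^sub>n x)\<close>, with integer part reset to the empty word when \<open>f\<^sub>n x \<in> A\<close>.
\<close>

subsection \<open>Words\<close>

lemma pre_Suc: "pre \<iota> (Suc k) = \<iota> 0 # pre (shift (Suc 0) \<iota>) k"
  unfolding pre_def shift_def by (rule nth_equalityI) (auto simp: nth_Cons' simp del: upt_Suc)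

lemma pre_eq_iff: "pre \<iota> k = pre \<omega> k \<longleftrightarrow> (\<forall>j<k. \<iota> j = \<omega> j)"
  by (auto simp: pre_def)

lemma shift_0 [simp]: "shift 0 \<iota> = \<iota>"
  by (simp add: shift_def)

lemma shift_shift [simp]: "shift j (shift k \<iota>) = shift (j + k) \<iota>"
  by (simp add: shift_def add.assoc)

lemma shift_sigma: "\<iota> 0 \<noteq> - n \<Longrightarrow> shift (Suc 0) (sigma n \<iota>) = \<iota>"
  by (auto simp: sigma_def shift_def One_nat_def)

lemma fword_Nil [simp]: "fword f [] = id"
  by (simp add: fword_def)

lemma fword_Cons [simp]: "fword f (n # w) = fx f n \<circ> fword f w"
  by (simp add: fword_def)

lemma fword_append: "fword f (u @ v) = fword f u \<circ> fword f v"
  by (induction u) (auto simp: fun_eq_iff)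

text \<open>Every member of a set is at most the Hausdorff distance away from the point. Compactness
  bounds the distances, without which the real \<open>SUP\<close> would carry no
  information.\<close>

lemma hconv_singletonD:
  assumes "hconv C {x}" "\<And>k. C k \<in> cpts" "e > 0"
  shows "\<forall>\<^sub>F k in sequentially. C k \<subseteq> ball x e"
proof -
  have "dist x s \<le> hausdorff_dist (C k) {x}" if "s \<in> C k" for s k
  proof -
    have "compact (C k)" using assms(2) by (auto simp: cpts_def)
    then have "bdd_above ((\<lambda>s. dist s x) ` C k)"
      by (intro bounded_imp_bdd_above compact_imp_bounded compact_continuous_image continuous_intros)
    then have "dist s x \<le> (SUP s\<in>C k. dist s x)"
      using that by (rule cSUP_upper2) auto
    then show ?thesis
      by (simp add: hausdorff_dist_def infdist_singleton dist_commute le_max_iff_disj)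
  qed
  moreover have "\<forall>\<^sub>F k in sequentially. hausdorff_dist (C k) {x} < e"
    using assms(1,3) unfolding hconv_def by (rule order_tendstoD)
  ultimately show ?thesis
    by (elim eventually_mono) (meson le_less_trans mem_ball subsetI)
qed

lemma dI_le: "\<forall>j<k. \<iota> j = \<omega> j \<Longrightarrow> dI \<iota> \<omega> \<le> (1/2) ^ k"
proof (cases "\<iota> = \<omega>")
  case False
  assume "\<forall>j<k. \<iota> j = \<omega> j"
  then have "k \<le> (LEAST j. \<iota> j \<noteq> \<omega> j)"
    using dI_neq(1)[OF False] not_le by blast
  then have "(1/2::real) ^ Suc (LEAST j. \<iota> j \<noteq> \<omega> j) \<le> (1/2) ^ k"
    by (intro power_decreasing) auto
  then show ?thesis by (simp only: dI_neq(2)[OF False])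
qed (simp add: dI_def)

lemma dI_lessD: "dI \<iota> \<omega> < (1/2) ^ k \<Longrightarrow> j < k \<Longrightarrow> \<iota> j = \<omega> j"
proof (rule ccontr)
  assume "dI \<iota> \<omega> < (1/2) ^ k" "j < k" "\<iota> j \<noteq> \<omega> j"
  \<comment> \<open>Index \<open>j\<close> weighs \<open>(1/2) ^ Suc j\<close>, so a disagreement at
    any \<open>j < k\<close> already costs \<open>(1/2) ^ k\<close>.\<close>
  moreover have "(1/2::real) ^ k \<le> (1/2) ^ Suc j"
    using \<open>j < k\<close> by (intro power_decreasing) auto
  ultimately show False using dI_ge[of \<iota> j \<omega>] by linarith
qed

text \<open>Balls of radius \<open>(1/2) ^ k\<close> are the cylinders over the first
  \<open>k\<close> letters, so continuity on words means dependence, up to \<open>e\<close>, on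
  finitely many letters.\<close>

lemma continuous_map_words_hatI:
  assumes "Metric_space M d" "\<And>\<iota>. \<iota> \<in> words_hat N \<Longrightarrow> g \<iota> \<in> M"
    and "\<And>\<iota> e. \<iota> \<in> words_hat N \<Longrightarrow> e > 0 \<Longrightarrow>
      \<exists>k. \<forall>\<omega>\<in>words_hat N. (\<forall>j<k. \<iota> j = \<omega> j) \<longrightarrow> d (g \<iota>) (g \<omega>) < e"
  shows "continuous_map (words_hat_top N) (Metric_space.mtopology M d) g"
  unfolding words_hat_top_def Metric_space.metric_continuous_map[OF Metric_space_dI assms(1)]
proof (intro conjI ballI allI impI)
  show "g ` words_hat N \<subseteq> M" using assms(2) by blast
next
  fix \<iota> and e :: real assume "\<iota> \<in> words_hat N" "e > 0"
  then obtain k where "\<forall>\<omega>\<in>words_hat N. (\<forall>j<k. \<iota> j = \<omega> j) \<longrightarrow> d (g \<iota>) (g \<omega>) < e"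
    using assms(3) by blast
  then show "\<exists>\<delta>>0. \<forall>\<omega>. \<omega> \<in> words_hat N \<and> dI \<iota> \<omega> < \<delta> \<longrightarrow> d (g \<iota>) (g \<omega>) < e"
    by (intro exI[of _ "(1/2) ^ k"]) (auto dest: dI_lessD)
qed

lemma take_pre: "take j (pre \<theta> k) = pre \<theta> (min j k)"
  by (simp add: pre_def take_map min_def)

lemma prefix_preE:
  assumes "prefix u (pre \<theta> k)"
  obtains j where "u = pre \<theta> j"
  using assms take_pre by (metis prefix_def append_eq_conv_conj)

lemma prefix_pre_mono: "j \<le> k \<Longrightarrow> prefix (pre \<theta> j) (pre \<theta> k)"
  using take_is_prefix[of j "pre \<theta> k"] by (simp add: take_pre)

lemma longest_common_prefix_commute:
  "longest_common_prefix xs ys = longest_common_prefix ys xs"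
  by (simp add: longest_common_prefix_max_prefix longest_common_prefix_prefix1
      longest_common_prefix_prefix2 prefix_order.antisym)

subsection \<open>Coding of the points of the fast basin\<close>

locale attractor_ifs =
  fixes f :: "nat \<Rightarrow> 'a::complete_space \<Rightarrow> 'a" and N :: nat and A :: "'a set"
  assumes IFS: "IFS N f" and attractor: "attractor N f A" and point_fibred: "point_fibred N f A"
begin

abbreviation letters :: "int set" where
  "letters \<equiv> Ipos N \<union> Ineg N"

abbreviation cod :: "(nat \<Rightarrow> int) \<Rightarrow> 'a" where
  "cod \<equiv> coding N f A"

lemma uminus_Ipos [simp]: "- n \<in> Ipos N \<longleftrightarrow> n \<in> Ineg N"
  and uminus_Ineg [simp]: "- n \<in> Ineg N \<longleftrightarrow> n \<in> Ipos N"
  by (auto simp: Ipos_def Ineg_def)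

lemma Ipos_Ineg_disjoint: "n \<in> Ipos N \<Longrightarrow> n \<notin> Ineg N"
  by (auto simp: Ipos_def Ineg_def)

lemma homeomorphism_fx:
  assumes "n \<in> letters"
  shows "homeomorphism UNIV UNIV (fx f n) (fx f (- n))"
proof -
  \<comment> \<open>The IFS provides only some inverse homeomorphism; uniqueness identifies it with
    \<open>inv\<close>, by which \<open>fx\<close> is defined on negative letters.\<close>
  have *: "homeomorphism UNIV UNIV (f k) (inv (f k))" if "k \<in> {1..N}" for k
  proof -
    obtain g where g: "homeomorphism UNIV UNIV (f k) g"
      using bspec[OF IFS[unfolded IFS_def] \<open>k \<in> {1..N}\<close>] by (elim exE)
    then have "inv (f k) = g"
      by (intro inv_unique_comp) (simp_all add: homeomorphism_def fun_eq_iff)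
    with g show ?thesis by (simp only:)
  qed
  show ?thesis
  proof (cases "n > 0")
    case True
    then show ?thesis using assms *[of "nat n"] by (auto simp: fx_def Ipos_def Ineg_def Suc_le_eq nat_le_iff)
  next
    case False
    then show ?thesis using assms *[of "nat (- n)", THEN homeomorphism_symD]
      by (auto simp: fx_def Ipos_def Ineg_def Suc_le_eq nat_le_iff)
  qed
qed

lemma fx_uminus [simp]:
  "n \<in> letters \<Longrightarrow> fx f n (fx f (- n) x) = x"
  "n \<in> letters \<Longrightarrow> fx f (- n) (fx f n x) = x"
  using homeomorphism_fx[of n] by (auto simp: homeomorphism_def)

lemma continuous_on_fx: "n \<in> letters \<Longrightarrow> continuous_on S (fx f n)"
  by (rule continuous_on_subset[OF homeomorphism_cont1[OF homeomorphism_fx] subset_UNIV])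

lemma inj_fx: "n \<in> letters \<Longrightarrow> inj (fx f n)"
  by (rule inj_on_inverseI[of _ "fx f (- n)"]) (rule fx_uminus(2))

lemma homeomorphism_fword:
  assumes "u \<in> lists letters"
  shows "\<exists>g. homeomorphism UNIV UNIV (fword f u) g"
  using assms
proof (induction u)
  case Nil
  then show ?case by (auto intro!: exI[of _ id] simp: homeomorphism_def)
next
  case (Cons n u)
  then obtain g where g: "homeomorphism UNIV UNIV (fword f u) g" by auto
  show ?case
    unfolding fword_Cons
    by (rule exI[of _ "g \<circ> fx f (- n)"], rule homeomorphism_compose[OF g homeomorphism_fx[OF Cons.hyps(1)]])
qed

lemma inj_fword:
  assumes "u \<in> lists letters"
  shows "inj (fword f u)"
proof -
  obtain g where "homeomorphism UNIV UNIV (fword f u) g"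
    using homeomorphism_fword[OF assms] by (elim exE)
  then show ?thesis
    by (intro inj_on_inverseI[of _ g]) (simp add: homeomorphism_def)
qed

lemma continuous_on_fword:
  assumes "u \<in> lists letters"
  shows "continuous_on S (fword f u)"
proof -
  obtain g where "homeomorphism UNIV UNIV (fword f u) g"
    using homeomorphism_fword[OF assms] by (elim exE)
  from homeomorphism_cont1[OF this] show ?thesis
    by (rule continuous_on_subset) simp
qed

lemma A_cpts: "A \<in> cpts" and compact_A: "compact A" and A_nonempty: "A \<noteq> {}"
  using attractor by (auto simp: attractor_def cpts_def)

lemma A_subset_basin: "A \<subseteq> basin N f A"
  using attractor by (auto simp: attractor_def basin_def attracting_nbhd_def)

lemma hutch_eq: "hutch N f S = (\<Union>n\<in>Ipos N. fx f n ` S)"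
proof -
  have "hutch N f S = (\<Union>n\<in>int ` {1..N}. fx f n ` S)" by (auto simp: fx_def hutch_def)
  then show ?thesis by (simp only: Ipos_def image_int_atLeastAtMost of_nat_1)
qed

lemma A_eq: "A = (\<Union>n\<in>Ipos N. fx f n ` A)"
  using attractor hutch_eq[of A] unfolding attractor_def by metis

lemma fx_pos_A: "n \<in> Ipos N \<Longrightarrow> fx f n ` A \<subseteq> A"
  by (subst (2) A_eq) blast

text \<open>Apply \<open>fx f n\<close> to the invariance of \<open>A\<close> under the positive
  letter \<open>- n\<close>. This is why the sets f_u(A) grow along negative words.\<close>

lemma A_subset_fx_neg: "n \<in> Ineg N \<Longrightarrow> A \<subseteq> fx f n ` A"
proof
  fix x assume n: "n \<in> Ineg N" and "x \<in> A"
  then have "fx f (- n) x \<in> A" using fx_pos_A[of "- n"] by auto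
  then have "fx f n (fx f (- n) x) \<in> fx f n ` A" by (rule imageI)
  then show "x \<in> fx f n ` A" using n by simp
qed

lemma pre_pos: "\<iota> \<in> words_pos N \<Longrightarrow> pre \<iota> k \<in> lists (Ipos N)"
  by (auto simp: words_pos_def pre_def)

lemma lists_letters: "u \<in> lists (Ipos N) \<Longrightarrow> u \<in> lists letters" "u \<in> lists (Ineg N) \<Longrightarrow> u \<in> lists letters"
  by auto

text \<open>Unlike \<open>coding\<close>, this relation has no junk values when the limit fails to exist.\<close>

definition codes :: "(nat \<Rightarrow> int) \<Rightarrow> 'a \<Rightarrow> bool" where
  "codes \<iota> x \<longleftrightarrow> (\<forall>b\<in>basin N f A. (\<lambda>k. fword f (pre \<iota> k) b) \<longlonglongrightarrow> x)"

text \<open>The basin contains the nonempty set \<open>A\<close>, so limits along it are unique and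
  the \<open>THE\<close> in \<open>coding\<close> is determined.\<close>

lemma coding_eqI: "codes \<iota> x \<Longrightarrow> cod \<iota> = x"
  using A_nonempty A_subset_basin
  unfolding coding_def codes_def by (blast intro: LIMSEQ_unique)

lemma codes_Cons:
  assumes "codes (shift (Suc 0) \<iota>) x" "\<iota> 0 \<in> letters"
  shows "codes \<iota> (fx f (\<iota> 0) x)"
  unfolding codes_def
proof
  fix b assume "b \<in> basin N f A"
  then have "(\<lambda>k. fx f (\<iota> 0) (fword f (pre (shift (Suc 0) \<iota>) k) b)) \<longlonglongrightarrow> fx f (\<iota> 0) x"
    using assms by (intro continuous_on_tendsto_compose[OF continuous_on_fx[of _ UNIV]])
      (auto simp: codes_def)
  then have "(\<lambda>k. fword f (pre \<iota> (Suc k)) b) \<longlonglongrightarrow> fx f (\<iota> 0) x"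
    by (simp add: pre_Suc)
  then show "(\<lambda>k. fword f (pre \<iota> k) b) \<longlonglongrightarrow> fx f (\<iota> 0) x"
    by (rule LIMSEQ_imp_Suc)
qed

text \<open>Point-fibredness is used for two compact sets only: a singleton \<open>{b}\<close>
  yields the coding limit, and \<open>A\<close> itself yields the shrinking of the images of
  \<open>A\<close>.\<close>

lemma point_fibred_pos:
  assumes "\<iota> \<in> words_pos N"
  obtains x where "x \<in> A" "codes \<iota> x"
    "\<And>e. e > 0 \<Longrightarrow> \<forall>\<^sub>F k in sequentially. fword f (pre \<iota> k) ` A \<subseteq> ball x e"
proof -
  obtain x where x: "x \<in> A" "\<And>C. C \<in> cpts \<Longrightarrow> C \<subseteq> basin N f A \<Longrightarrow> hconv (\<lambda>k. fword f (pre \<iota> k) ` C) {x}"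
    using point_fibred assms unfolding point_fibred_def by blast
  have c: "fword f (pre \<iota> k) ` C \<in> cpts" if "C \<in> cpts" for C k
    using that pre_pos[OF assms, of k]
    by (auto simp: cpts_def simp del: in_lists_conv_set intro!: compact_continuous_image continuous_on_fword lists_letters(1))
  have ball: "\<forall>\<^sub>F k in sequentially. fword f (pre \<iota> k) ` C \<subseteq> ball x e"
    if "C \<in> cpts" "C \<subseteq> basin N f A" "e > 0" for C e
    using hconv_singletonD[OF x(2)[OF that(1,2)] c[OF that(1)] that(3)] .
  have "codes \<iota> x"
    unfolding codes_def tendsto_iff
  proof (intro ballI allI impI)
    fix b and e :: real assume "b \<in> basin N f A" "e > 0"
    with ball[of "{b}" e] show "\<forall>\<^sub>F k in sequentially. dist (fword f (pre \<iota> k) b) x < e"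
      by (simp add: cpts_def dist_commute)
  qed
  with x(1) show ?thesis using ball[OF A_cpts A_subset_basin] by (rule that)
qed

lemma coding_pos: "\<iota> \<in> words_pos N \<Longrightarrow> cod \<iota> \<in> A"
  using coding_eqI by (metis point_fibred_pos)

lemma codes_pos: "\<iota> \<in> words_pos N \<Longrightarrow> codes \<iota> (cod \<iota>)"
  using coding_eqI by (metis point_fibred_pos)

lemma words_pos_hat:
  assumes "\<iota> \<in> words_pos N"
  shows "\<iota> \<in> words_hat N"
proof -
  have p: "\<iota> i \<in> Ipos N" for i
    using assms by (simp add: words_pos_def)
  have "\<iota> i \<noteq> - \<iota> (Suc i)" for i
    using p[of i] p[of "Suc i"] unfolding Ipos_def atLeastAtMost_iff by linarith
  with p show ?thesis
    unfolding words_hat_def words_def by auto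
qed

lemma shift_words_hat: "\<iota> \<in> words_hat N \<Longrightarrow> shift k \<iota> \<in> words_hat N"
proof -
  assume "\<iota> \<in> words_hat N"
  then obtain m where w: "\<iota> \<in> words N" and m: "\<forall>j<m. \<iota> j \<in> Ineg N" "\<forall>j\<ge>m. \<iota> j \<in> Ipos N"
    unfolding words_hat_def by blast
  \<comment> \<open>Truncated subtraction is intended: once \<open>k\<close> exceeds
    \<open>m\<close>, the shifted word is positive from index 0 on.\<close>
  have "\<forall>j<m - k. shift k \<iota> j \<in> Ineg N" "\<forall>j\<ge>m - k. shift k \<iota> j \<in> Ipos N"
    using m by (auto simp: shift_def)
  moreover have "shift k \<iota> \<in> words N"
    using w by (auto simp: words_def shift_def)
  ultimately show ?thesis unfolding words_hat_def by blast
qed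

lemma words_hat_letter: "\<iota> \<in> words_hat N \<Longrightarrow> \<iota> k \<in> letters"
  by (auto simp: words_hat_def words_def)

lemma words_hat_reduced: "\<iota> \<in> words_hat N \<Longrightarrow> \<iota> k \<noteq> - \<iota> (Suc k)"
  by (auto simp: words_hat_def words_def)

text \<open>The sign of the letters changes at most once, from negative to positive, so nothing
  negative follows a positive letter.\<close>

lemma words_hat_pos:
  assumes "\<iota> \<in> words_hat N" "\<iota> k \<in> Ipos N"
  shows "shift k \<iota> \<in> words_pos N"
proof -
  obtain m where m: "\<forall>j<m. \<iota> j \<in> Ineg N" "\<forall>j\<ge>m. \<iota> j \<in> Ipos N"
    using assms unfolding words_hat_def by blast
  then have "m \<le> k" using assms(2) Ipos_Ineg_disjoint not_le by blast
  then show ?thesis using m by (auto simp: words_pos_def shift_def)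
qed

lemma words_hat_cases [consumes 1, case_names pos neg]:
  assumes "\<iota> \<in> words_hat N"
  obtains "\<iota> \<in> words_pos N" | "\<iota> 0 \<in> Ineg N"
  using assms words_hat_letter[of \<iota> 0] words_hat_pos[of \<iota> 0] by auto

text \<open>Induction on a bound for the number of leading negative letters, which each shift lowers
  by one.\<close>

lemma words_hat_induct [consumes 1, case_names pos neg]:
  assumes "\<iota> \<in> words_hat N"
    and pos: "\<And>\<iota>. \<iota> \<in> words_pos N \<Longrightarrow> P \<iota>"
    and neg: "\<And>\<iota>. \<iota> \<in> words_hat N \<Longrightarrow> \<iota> 0 \<in> Ineg N \<Longrightarrow> P (shift (Suc 0) \<iota>) \<Longrightarrow> P \<iota>"
  shows "P \<iota>"
proof -
  obtain k where "\<forall>j\<ge>k. \<iota> j \<in> Ipos N" using assms(1) by (auto simp: words_hat_def)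
  with assms(1) show ?thesis
  proof (induction k arbitrary: \<iota>)
    case 0
    then show ?case by (intro pos) (auto simp: words_pos_def)
  next
    case (Suc k)
    have "P (shift (Suc 0) \<iota>)"
      by (rule Suc.IH) (use Suc.prems shift_words_hat[of \<iota> 1] in \<open>auto simp: shift_def\<close>)
    with Suc.prems(1) show ?case
      using pos neg words_hat_cases by metis
  qed
qed

lemma codes_hat: "\<iota> \<in> words_hat N \<Longrightarrow> codes \<iota> (cod \<iota>)"
proof (induction rule: words_hat_induct)
  case (pos \<iota>)
  then show ?case by (rule codes_pos)
next
  case (neg \<iota>)
  from codes_Cons[OF neg(3)] neg(2) have "codes \<iota> (fx f (\<iota> 0) (cod (shift (Suc 0) \<iota>)))" by simp
  then show ?case using coding_eqI by metis
qed

lemma coding_Cons: "\<iota> \<in> words_hat N \<Longrightarrow> cod \<iota> = fx f (\<iota> 0) (cod (shift (Suc 0) \<iota>))"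
proof -
  assume \<iota>: "\<iota> \<in> words_hat N"
  have "codes \<iota> (fx f (\<iota> 0) (cod (shift (Suc 0) \<iota>)))"
    using codes_hat[OF shift_words_hat[OF \<iota>]] words_hat_letter[OF \<iota>] by (rule codes_Cons)
  then show ?thesis by (rule coding_eqI)
qed

lemma coding_pre: "\<iota> \<in> words_hat N \<Longrightarrow> cod \<iota> = fword f (pre \<iota> k) (cod (shift k \<iota>))"
proof (induction k arbitrary: \<iota>)
  case 0
  then show ?case by (simp add: pre_def)
next
  case (Suc k)
  from Suc.IH[OF shift_words_hat[of _ 1, OF Suc.prems]] show ?case
    using coding_Cons[OF Suc.prems] by (simp add: pre_Suc)
qed

text \<open>Since \<open>A\<close> is the union of its images, each point of \<open>A\<close> has a
  letter and a preimage in \<open>A\<close>. Iterating this choice gives an address whose images of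
  \<open>A\<close> all contain \<open>x\<close> and shrink to the coded point.\<close>

lemma coding_surj:
  assumes "x \<in> A"
  obtains \<iota> where "\<iota> \<in> words_pos N" "cod \<iota> = x"
proof -
  have "\<exists>n. \<exists>y\<in>A. n \<in> Ipos N \<and> z = fx f n y" if "z \<in> A" for z
    using that by (subst (asm) A_eq) blast
  then obtain l p where lp: "\<And>z. z \<in> A \<Longrightarrow> l z \<in> Ipos N \<and> p z \<in> A \<and> z = fx f (l z) (p z)"
    by metis
  \<comment> \<open>The itinerary of \<open>x\<close> under the chosen preimage map
    \<open>p\<close>.\<close>
  define \<iota> where "\<iota> x = (\<lambda>k. l ((p ^^ k) x))" for x
  have pA: "(p ^^ k) x \<in> A" if "x \<in> A" for k x
    using that lp by (induction k) auto
  have shift: "shift (Suc 0) (\<iota> x) = \<iota> (p x)" for x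
    by (simp add: \<iota>_def shift_def fun_eq_iff funpow_swap1)
  have eq: "x = fword f (pre (\<iota> x) k) ((p ^^ k) x)" if "x \<in> A" for x k
    using that
  proof (induction k arbitrary: x)
    case (Suc k)
    then show ?case
      using lp[OF Suc.prems] Suc.IH[of "p x"]
      by (simp add: pre_Suc shift funpow_swap1) (simp add: \<iota>_def)
  qed (simp add: pre_def)
  have w: "\<iota> x \<in> words_pos N"
    using pA[OF assms] lp by (auto simp: words_pos_def \<iota>_def)
  then obtain z where z: "codes (\<iota> x) z"
    "\<And>e. e > 0 \<Longrightarrow> \<forall>\<^sub>F k in sequentially. fword f (pre (\<iota> x) k) ` A \<subseteq> ball z e"
    by (rule point_fibred_pos) blast
  have "dist z x < e" if "e > 0" for e
    using eventually_happens'[OF sequentially_bot z(2)[OF that]] eq[OF assms] pA[OF assms]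
    by (auto simp: subset_iff)
  then have "z = x" by (metis dist_pos_lt less_irrefl)
  with w z(1) show ?thesis using that coding_eqI by blast
qed

text \<open>Replaces the \<open>LEAST\<close> of the definition by a recursion on the first letter,
  the form in which integer parts are computed from here on.\<close>

lemma int_part_rec:
  assumes "\<iota> \<in> words_hat N"
  shows "int_part N f A \<iota> = (if cod \<iota> \<in> A then [] else \<iota> 0 # int_part N f A (shift (Suc 0) \<iota>))"
proof (cases "cod \<iota> \<in> A")
  case True
  then have "(LEAST k. cod (shift k \<iota>) \<in> A) = 0" by (intro Least_equality) auto
  with True show ?thesis by (simp add: int_part_def pre_def)
next
  case False
  \<comment> \<open>Some tail is positive and hence coded in \<open>A\<close>, so the
    \<open>LEAST\<close> exists.\<close>
  obtain k where "\<iota> k \<in> Ipos N" using assms by (auto simp: words_hat_def)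
  then have "cod (shift k \<iota>) \<in> A" using words_hat_pos[OF assms] coding_pos by blast
  then have "(LEAST k. cod (shift k \<iota>) \<in> A) = Suc (LEAST k. cod (shift (Suc k) \<iota>) \<in> A)"
    by (rule Least_Suc) (use False in simp)
  with False show ?thesis by (simp add: int_part_def pre_Suc)
qed

lemma int_part_neg: "\<iota> \<in> words_hat N \<Longrightarrow> int_part N f A \<iota> \<in> lists (Ineg N)"
  by (induction rule: words_hat_induct)
    (auto simp: int_part_rec words_pos_hat coding_pos)

text \<open>A positive tail is coded in \<open>A\<close>, so the integer part stops no later than
  the first positive letter. This later bounds the integer parts of all words close to \<iota> by
  one common word.\<close>

lemma int_part_prefix_pre:
  assumes "\<iota> \<in> words_hat N" "\<iota> m \<in> Ipos N"
  shows "prefix (int_part N f A \<iota>) (pre \<iota> m)"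
  using assms
proof (induction m arbitrary: \<iota>)
  case 0
  then have "cod \<iota> \<in> A" using words_hat_pos[of \<iota> 0] coding_pos by simp
  with 0 show ?case by (simp add: int_part_rec)
next
  case (Suc m)
  then show ?case
    using Suc.IH[of "shift (Suc 0) \<iota>"] shift_words_hat[of \<iota> 1]
    by (simp add: int_part_rec pre_Suc shift_def)
qed

subsection \<open>Continuation along a word\<close>

definition K :: "int list \<Rightarrow> 'a set" where
  "K u = fword f u ` A"

lemma K_Nil [simp]: "K [] = A"
  by (simp add: K_def)

lemma K_Cons: "K (n # u) = fx f n ` K u"
  by (simp add: K_def image_comp)

lemma compact_K: "u \<in> lists (Ineg N) \<Longrightarrow> compact (K u)"
  unfolding K_def by (intro compact_continuous_image continuous_on_fword lists_letters compact_A)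

lemma K_nonempty: "K u \<noteq> {}"
  using A_nonempty by (simp add: K_def)

text \<open>One more negative letter enlarges \<open>A\<close>; the maps of the preceding letters
  transport that inclusion.\<close>

lemma K_mono:
  assumes "prefix u v" "v \<in> lists (Ineg N)"
  shows "K u \<subseteq> K v"
  using assms
proof (induction v arbitrary: u)
  case (Cons n v)
  show ?case
  proof (cases u)
    case Nil
    have "A \<subseteq> fx f n ` A" using Cons.prems A_subset_fx_neg by auto
    also have "\<dots> \<subseteq> fx f n ` K v" using Cons.IH[of "[]"] Cons.prems by auto
    finally show ?thesis using Nil by (simp add: K_Cons)
  next
    case (Cons m u')
    then show ?thesis using Cons.prems Cons.IH[of u'] by (auto simp: K_Cons)
  qed
qed simp

lemma coding_in_K: "\<iota> \<in> words_hat N \<Longrightarrow> cod \<iota> \<in> K (int_part N f A \<iota>)"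
proof (induction rule: words_hat_induct)
  case (pos \<iota>)
  then show ?case by (simp add: int_part_rec words_pos_hat coding_pos)
next
  case (neg \<iota>)
  then show ?case by (auto simp: int_part_rec K_Cons intro!: image_eqI coding_Cons)
qed

text \<open>By injectivity of f_u, membership in \<open>K u\<close> would put the point coded by the
  tail after \<open>u\<close> into \<open>A\<close>, against minimality of the integer part.\<close>

lemma coding_notin_K:
  assumes "\<iota> \<in> words_hat N" "strict_prefix u (int_part N f A \<iota>)"
  shows "cod \<iota> \<notin> K u"
  using assms
proof (induction u arbitrary: \<iota>)
  case Nil
  then show ?case by (auto simp: int_part_rec)
next
  case (Cons n u)
  then have n: "n = \<iota> 0" "strict_prefix u (int_part N f A (shift (Suc 0) \<iota>))"
    by (auto simp: int_part_rec split: if_splits)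
  then have "cod (shift (Suc 0) \<iota>) \<notin> K u" using Cons shift_words_hat by blast
  then show ?case
    using n inj_fx[OF words_hat_letter[OF Cons.prems(1), of 0]] coding_Cons[OF Cons.prems(1)]
    by (auto simp: K_Cons inj_eq)
qed

section \<open>Action of the negative letters on words\<close>

lemma sigma_words_hat:
  assumes "n \<in> Ineg N" "\<iota> \<in> words_hat N"
  shows "sigma n \<iota> \<in> words_hat N"
proof (cases "\<iota> 0 = - n")
  case True
  then show ?thesis using assms shift_words_hat[of \<iota> 1] by (simp add: sigma_def)
next
  case False
  obtain m where w: "\<iota> \<in> words N" and m: "\<forall>j<m. \<iota> j \<in> Ineg N" "\<forall>j\<ge>m. \<iota> j \<in> Ipos N"
    using assms unfolding words_hat_def by blast
  have s: "sigma n \<iota> = case_nat n \<iota>" using False by (simp add: sigma_def)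
  have "\<forall>j<Suc m. sigma n \<iota> j \<in> Ineg N" "\<forall>j\<ge>Suc m. sigma n \<iota> j \<in> Ipos N"
    using m assms(1) by (auto simp: s split: nat.split)
  moreover have "sigma n \<iota> \<in> words N"
    \<comment> \<open>The only new pair of neighbours is \<open>n\<close> and
      \<open>\<iota> 0\<close>, and it is reduced because no cancellation takes place.\<close>
    using w False assms(1) by (auto simp: words_def s split: nat.split)
  ultimately show ?thesis unfolding words_hat_def by blast
qed

lemma coding_sigma:
  assumes "n \<in> Ineg N" "\<iota> \<in> words_hat N"
  shows "cod (sigma n \<iota>) = fx f n (cod \<iota>)"
proof (cases "\<iota> 0 = - n")
  case True
  then show ?thesis using assms coding_Cons[OF assms(2)] by (simp add: sigma_def)
next
  case False
  then show ?thesis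
    using coding_Cons[OF sigma_words_hat[OF assms]] shift_sigma[of \<iota> n] False by (simp add: sigma_def)
qed

lemma int_part_sigma:
  assumes "n \<in> Ineg N" "\<iota> \<in> words_hat N"
  shows "int_part N f A (sigma n \<iota>) =
    (if fx f n (cod \<iota>) \<in> A then [] else n # int_part N f A \<iota>)"
proof (cases "fx f n (cod \<iota>) \<in> A")
  case True
  then show ?thesis using assms by (simp add: int_part_rec sigma_words_hat coding_sigma)
next
  case False
  \<comment> \<open>Cancellation needs the positive first letter \<open>- n\<close>, which makes the
    whole word positive; what remains is then coded in \<open>A\<close>.\<close>
  have "\<iota> 0 \<noteq> - n"
  proof
    assume "\<iota> 0 = - n"
    then have "\<iota> \<in> words_pos N" using assms words_hat_pos[of \<iota> 0] by simp
    then have "shift (Suc 0) \<iota> \<in> words_pos N" by (auto simp: words_pos_def shift_def)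
    then have "cod (sigma n \<iota>) \<in> A" using \<open>\<iota> 0 = - n\<close> by (simp add: sigma_def coding_pos)
    with False show False using assms by (simp add: coding_sigma)
  qed
  then show ?thesis using False assms shift_sigma[of \<iota> n]
    by (simp add: int_part_rec[of "sigma n \<iota>"] sigma_words_hat coding_sigma) (simp add: sigma_def)
qed

text \<open>Start from an address of a point of \<open>A\<close> and apply \<open>sigma\<close> for
  the letters of \<open>u\<close> from the last to the first. Each step may reset the integer part
  to the empty word, hence only a prefix of \<open>u\<close>.\<close>

lemma K_obtain_word:
  assumes "u \<in> lists (Ineg N)" "x \<in> K u"
  shows "\<exists>\<iota>\<in>words_hat N. prefix (int_part N f A \<iota>) u \<and> cod \<iota> = x"
  using assms
proof (induction u arbitrary: x)
  case Nil
  then obtain \<iota> where "\<iota> \<in> words_pos N" "cod \<iota> = x" using coding_surj by auto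
  with Nil show ?case by (intro bexI[of _ \<iota>]) (auto simp: int_part_rec words_pos_hat)
next
  case (Cons n u)
  then obtain y where y: "x = fx f n y" "y \<in> K u" by (auto simp: K_Cons)
  with Cons obtain \<iota>
    where "\<iota> \<in> words_hat N" "prefix (int_part N f A \<iota>) u" "cod \<iota> = y" by auto
  moreover have "n \<in> Ineg N" using Cons.hyps(1) .
  ultimately show ?case using y
    by (intro bexI[of _ "sigma n \<iota>"]) (auto simp: sigma_words_hat coding_sigma int_part_sigma)
qed

subsection \<open>The leaf space as a set\<close>

abbreviation L :: "(nat \<Rightarrow> int) set set" where
  "L \<equiv> Lspace N f A"

abbreviation cls :: "(nat \<Rightarrow> int) \<Rightarrow> (nat \<Rightarrow> int) set" where
  "cls \<equiv> pi_tilde N f A"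

abbreviation proj :: "(nat \<Rightarrow> int) set \<Rightarrow> 'a" where
  "proj \<equiv> pi_hat N f A"

abbreviation ipart :: "(nat \<Rightarrow> int) set \<Rightarrow> int list" where
  "ipart \<equiv> Lint N f A"

lemma cls_in_L [simp]: "\<iota> \<in> words_hat N \<Longrightarrow> cls \<iota> \<in> L"
  by (auto simp: Lspace_def pi_tilde_def quotient_def)

lemma L_cases:
  assumes "\<alpha> \<in> L"
  obtains \<iota> where "\<iota> \<in> words_hat N" "\<alpha> = cls \<iota>"
  using assms by (auto simp: Lspace_def pi_tilde_def quotient_def)

lemma cls_eq: "\<iota> \<in> words_hat N \<Longrightarrow>
    cls \<iota> = {\<omega> \<in> words_hat N. int_part N f A \<omega> = int_part N f A \<iota> \<and> cod \<omega> = cod \<iota>}"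
  by (auto simp: pi_tilde_def Lrel_def)

text \<open>Well-definedness of the induced maps: \<open>the_elem\<close> is meaningful only on a
  singleton, that is, for maps constant on the class.\<close>

lemma the_elem_cls:
  assumes "\<iota> \<in> words_hat N"
    and "\<And>\<omega>. \<omega> \<in> words_hat N \<Longrightarrow> int_part N f A \<omega> = int_part N f A \<iota> \<Longrightarrow> cod \<omega> = cod \<iota> \<Longrightarrow> h \<omega> = h \<iota>"
  shows "the_elem (h ` cls \<iota>) = h \<iota>"
proof -
  have "h \<omega> = h \<iota>" if "\<omega> \<in> cls \<iota>" for \<omega>
    using that assms unfolding cls_eq[OF assms(1)] by blast
  moreover have "\<iota> \<in> cls \<iota>" using assms(1) by (simp add: cls_eq)
  ultimately have "h ` cls \<iota> = {h \<iota>}" by blast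
  then show ?thesis by simp
qed

lemma proj_cls [simp]: "\<iota> \<in> words_hat N \<Longrightarrow> proj (cls \<iota>) = cod \<iota>"
  unfolding pi_hat_def by (rule the_elem_cls) auto

lemma ipart_cls [simp]: "\<iota> \<in> words_hat N \<Longrightarrow> ipart (cls \<iota>) = int_part N f A \<iota>"
  unfolding Lint_def by (rule the_elem_cls) auto

lemma sigma_tilde_cls [simp]:
  assumes "n \<in> Ineg N" "\<iota> \<in> words_hat N"
  shows "sigma_tilde N f A n (cls \<iota>) = cls (sigma n \<iota>)"
  unfolding sigma_tilde_def using assms
  by (intro the_elem_cls) (auto simp: cls_eq sigma_words_hat int_part_sigma coding_sigma)

text \<open>Integer part and projection form a complete invariant of a class, so the representatives
  can be forgotten.\<close>

lemma L_eqI: "\<alpha> \<in> L \<Longrightarrow> \<beta> \<in> L \<Longrightarrow> ipart \<alpha> = ipart \<beta> \<Longrightarrow> proj \<alpha> = proj \<beta> \<Longrightarrow> \<alpha> = \<beta>"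
proof -
  assume "\<alpha> \<in> L" "\<beta> \<in> L" and eq: "ipart \<alpha> = ipart \<beta>" "proj \<alpha> = proj \<beta>"
  then obtain \<iota> \<omega> where w: "\<iota> \<in> words_hat N" "\<alpha> = cls \<iota>" "\<omega> \<in> words_hat N" "\<beta> = cls \<omega>"
    by (metis L_cases)
  with eq have "int_part N f A \<iota> = int_part N f A \<omega>" "cod \<iota> = cod \<omega>" by simp_all
  with w show "\<alpha> = \<beta>" by (simp only: cls_eq)
qed

lemma ipart_neg: "\<alpha> \<in> L \<Longrightarrow> ipart \<alpha> \<in> lists (Ineg N)"
  by (elim L_cases) (simp add: int_part_neg del: in_lists_conv_set)

lemma proj_in_K: "\<alpha> \<in> L \<Longrightarrow> proj \<alpha> \<in> K (ipart \<alpha>)"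
  by (elim L_cases) (simp add: coding_in_K)

lemma proj_notin_K: "\<alpha> \<in> L \<Longrightarrow> strict_prefix u (ipart \<alpha>) \<Longrightarrow> proj \<alpha> \<notin> K u"
  using coding_notin_K ipart_cls proj_cls by (metis L_cases)

lemma K_obtain:
  assumes "u \<in> lists (Ineg N)" "x \<in> K u"
  obtains \<alpha> where "\<alpha> \<in> L" "prefix (ipart \<alpha>) u" "proj \<alpha> = x"
  using K_obtain_word[OF assms] cls_in_L ipart_cls proj_cls by metis

lemma sigma_tilde_props:
  assumes "n \<in> Ineg N" "\<alpha> \<in> L"
  shows "sigma_tilde N f A n \<alpha> \<in> L"
    and "proj (sigma_tilde N f A n \<alpha>) = fx f n (proj \<alpha>)"
    and "ipart (sigma_tilde N f A n \<alpha>) = (if fx f n (proj \<alpha>) \<in> A then [] else n # ipart \<alpha>)"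
proof -
  obtain \<iota> where "\<iota> \<in> words_hat N" "\<alpha> = cls \<iota>" using L_cases[OF assms(2)] .
  with assms(1) show "sigma_tilde N f A n \<alpha> \<in> L"
    "proj (sigma_tilde N f A n \<alpha>) = fx f n (proj \<alpha>)"
    "ipart (sigma_tilde N f A n \<alpha>) = (if fx f n (proj \<alpha>) \<in> A then [] else n # ipart \<alpha>)"
    by (simp_all add: sigma_words_hat coding_sigma int_part_sigma)
qed

lemma panicle_eq: "panicle N f A u = {\<alpha> \<in> L. prefix (ipart \<alpha>) u}"
proof -
  have "(\<exists>k\<in>{0..length u}. v = take k u) \<longleftrightarrow> prefix v u" for v
  proof
    assume "prefix v u"
    then have "v = take (length v) u" "length v \<le> length u"
      by (auto simp: prefix_def)
    then show "\<exists>k\<in>{0..length u}. v = take k u" by (intro bexI[of _ "length v"]) auto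
  qed (auto simp: take_is_prefix)
  then show ?thesis unfolding panicle_def leaf_def by blast
qed

lemma proj_panicle:
  assumes "u \<in> lists (Ineg N)"
  shows "proj ` panicle N f A u = K u"
proof (intro equalityI subsetI)
  fix x assume "x \<in> proj ` panicle N f A u"
  then obtain \<alpha> where "\<alpha> \<in> L" "prefix (ipart \<alpha>) u" "x = proj \<alpha>" by (auto simp: panicle_eq)
  then show "x \<in> K u" using proj_in_K K_mono[OF _ assms] by blast
next
  fix x assume "x \<in> K u"
  then obtain \<alpha> where "\<alpha> \<in> L" "prefix (ipart \<alpha>) u" "proj \<alpha> = x" using K_obtain[OF assms] by metis
  then show "x \<in> proj ` panicle N f A u" by (auto simp: panicle_eq)
qed

lemma sheet_eq: "sheet N f A \<theta> = {\<alpha> \<in> L. \<exists>k. ipart \<alpha> = pre \<theta> k}"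
  by (auto simp: sheet_def leaf_def)

lemma pre_neg: "\<theta> \<in> words_neg N \<Longrightarrow> pre \<theta> k \<in> lists (Ineg N)"
  by (auto simp: words_neg_def pre_def)

text \<open>The two negations cancel, and the separate term \<open>A\<close> of the continuation is
  the one for \<open>k = 0\<close>.\<close>

lemma continuation_eq: "continuation f A (\<lambda>i. - \<theta> i) = (\<Union>k. K (pre \<theta> k))"
proof -
  have "map uminus (pre (\<lambda>i. - \<theta> i) k) = pre \<theta> k" for k
    by (simp add: pre_def)
  then have "continuation f A (\<lambda>i. - \<theta> i) = K (pre \<theta> 0) \<union> (\<Union>k\<in>{1..}. K (pre \<theta> k))"
    unfolding continuation_def K_def by (simp only: pre_def upt_0 list.map(1) fword_Nil image_id id_apply)
  also have "\<dots> = (\<Union>k\<in>insert 0 {1..}. K (pre \<theta> k))" by simp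
  also have "insert 0 {1..} = (UNIV :: nat set)" by auto
  finally show ?thesis .
qed

lemma proj_sheet:
  assumes "\<theta> \<in> words_neg N"
  shows "proj ` sheet N f A \<theta> = continuation f A (\<lambda>i. - \<theta> i)"
proof (intro equalityI subsetI)
  fix x assume "x \<in> proj ` sheet N f A \<theta>"
  then show "x \<in> continuation f A (\<lambda>i. - \<theta> i)"
    using proj_in_K by (force simp: sheet_eq continuation_eq)
next
  fix x assume "x \<in> continuation f A (\<lambda>i. - \<theta> i)"
  then obtain k where "x \<in> K (pre \<theta> k)" by (auto simp: continuation_eq)
  then obtain \<alpha> where "\<alpha> \<in> L" "prefix (ipart \<alpha>) (pre \<theta> k)" "proj \<alpha> = x"
    using K_obtain[OF pre_neg[OF assms]] by metis
  then show "x \<in> proj ` sheet N f A \<theta>"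
    unfolding sheet_eq by (metis (mono_tags, lifting) imageI mem_Collect_eq prefix_preE)
qed

section \<open>Leaves\<close>

text \<open>For a point \<open>y\<close> of f_n(A) outside \<open>A\<close>, f_v(y) lies in
  \<open>K (v @ [n])\<close> but not in \<open>K v\<close>. If \<open>A\<close> is a single point,
  all maps fix it, every \<open>K u\<close> equals \<open>A\<close>, and only the leaf of the empty
  word is inhabited.\<close>

lemma leaf_nonempty:
  assumes u: "u \<in> lists (Ineg N)" and "u = [] \<or> \<not> is_singleton A"
  shows "leaf N f A u \<noteq> {}"
proof (cases u rule: rev_cases)
  case Nil
  obtain x where "x \<in> A" using A_nonempty by blast
  then obtain \<alpha> where "\<alpha> \<in> L" "prefix (ipart \<alpha>) []" using K_obtain[of "[]" x] by auto
  then show ?thesis using Nil by (auto simp: leaf_def)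
next
  case (snoc v n)
  have n: "n \<in> Ineg N" and v: "v \<in> lists (Ineg N)" using u snoc by auto
  \<comment> \<open>Otherwise the constant word with letter \<open>- n\<close> would reproduce
    \<open>A\<close> at every stage, although these images shrink to a point.\<close>
  have "fx f n ` A \<noteq> A"
  proof
    assume eq: "fx f n ` A = A"
    define m where "m = - n"
    have m: "m \<in> Ipos N" using n by (simp add: m_def)
    have fixm: "fx f m ` A = A"
      using eq n image_image[of "fx f (- n)" "fx f n" A] by (simp add: m_def)
    have w: "(\<lambda>_. m) \<in> words_pos N" using m by (simp add: words_pos_def)
    have fixk: "fword f (pre (\<lambda>_. m) k) ` A = A" for k
    proof (induction k)
      case (Suc k)
      have "shift (Suc 0) (\<lambda>_. m) = (\<lambda>_. m)" by (simp add: shift_def)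
      then show ?case by (simp only: pre_Suc fword_Cons image_comp[symmetric] Suc fixm)
    qed (simp add: pre_def)
    obtain x where "x \<in> A" "codes (\<lambda>_. m) x"
      and "\<And>e. e > 0 \<Longrightarrow> \<forall>\<^sub>F k in sequentially. fword f (pre (\<lambda>_. m) k) ` A \<subseteq> ball x e"
      by (rule point_fibred_pos[OF w]) blast
    then have x: "x \<in> A" "\<And>e. e > 0 \<Longrightarrow> A \<subseteq> ball x e"
      by (simp_all only: fixk eventually_const[OF sequentially_bot])
    have "y = x" if "y \<in> A" for y
      using x(2) that by (metis dist_pos_lt less_irrefl mem_ball subsetD)
    then have "A = {x}" using x(1) by blast
    then show False using assms(2) snoc by (simp add: is_singleton_def)
  qed
  then obtain y where y: "y \<in> fx f n ` A" "y \<notin> A" using A_subset_fx_neg[OF n] by blast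
  define x where "x = fword f v y"
  have "x \<in> K u" using y snoc by (auto simp: K_def fword_append x_def)
  then obtain \<alpha> where \<alpha>: "\<alpha> \<in> L" "prefix (ipart \<alpha>) u" "proj \<alpha> = x"
    using K_obtain[OF u] by metis
  \<comment> \<open>This forces the integer part to be all of \<open>u\<close>: it is a prefix of
    \<open>u\<close> but not of \<open>v\<close>.\<close>
  have "x \<notin> K v"
    using y inj_fword[OF lists_letters(2)[OF v]] by (auto simp: K_def x_def inj_eq)
  then have "\<not> prefix (ipart \<alpha>) v"
    using \<alpha> proj_in_K[OF \<alpha>(1)] K_mono[OF _ v] by blast
  then have "ipart \<alpha> = u" using \<alpha>(2) snoc by simp
  then show ?thesis using \<alpha>(1) by (auto simp: leaf_def)
qed

text \<open>Leaves are the fibres of the integer part. The empty set is removed because it may occur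
  as a leaf and is no block of a partition.\<close>

lemma partition_leaves: "partition_on L (leaves N f A - {{}})"
proof (rule partition_onI)
  show "\<Union> (leaves N f A - {{}}) = L"
  proof (intro equalityI subsetI)
    fix \<alpha> assume "\<alpha> \<in> L"
    then have "\<alpha> \<in> leaf N f A (ipart \<alpha>)" "leaf N f A (ipart \<alpha>) \<in> leaves N f A"
      using ipart_neg by (auto simp: leaf_def leaves_def)
    then show "\<alpha> \<in> \<Union> (leaves N f A - {{}})" by blast
  qed (auto simp: leaves_def leaf_def)
qed (auto simp: leaves_def leaf_def disjnt_def)

section \<open>The fast basin\<close>

lemma hutch_funpow_singleton:
  "(hutch N f ^^ k) {x} = (\<lambda>u. fword f u x) ` {u \<in> lists (Ipos N). length u = k}"
proof (induction k)
  case 0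
  have "{u \<in> lists (Ipos N). length u = 0} = {[]}" by auto
  then show ?case by (simp only: funpow_0 image_insert image_empty fword_Nil id_apply)
next
  case (Suc k)
  have "(hutch N f ^^ Suc k) {x} =
      (\<Union>n\<in>Ipos N. (\<lambda>u. fword f (n # u) x) ` {u \<in> lists (Ipos N). length u = k})"
    unfolding funpow.simps o_apply Suc hutch_eq fword_Cons image_image ..
  also have "\<dots> = (\<lambda>u. fword f u x) `
      (\<Union>n\<in>Ipos N. (#) n ` {u \<in> lists (Ipos N). length u = k})"
    unfolding image_UN image_image ..
  also have "(\<Union>n\<in>Ipos N. (#) n ` {u \<in> lists (Ipos N). length u = k}) =
      {u \<in> lists (Ipos N). length u = Suc k}"
  proof (intro equalityI subsetI)
    fix v assume "v \<in> {u \<in> lists (Ipos N). length u = Suc k}"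
    then obtain n u where v: "v = n # u" "length u = k" "v \<in> lists (Ipos N)"
      unfolding mem_Collect_eq length_Suc_conv by blast
    then have "n \<in> Ipos N" "u \<in> lists (Ipos N)" by auto
    with v show "v \<in> (\<Union>n\<in>Ipos N. (#) n ` {u \<in> lists (Ipos N). length u = k})" by blast
  qed auto
  finally show ?case .
qed

lemma fword_inverse: "u \<in> lists letters \<Longrightarrow> fword f (rev (map uminus u)) (fword f u x) = x"
proof (induction u arbitrary: x rule: lists.induct)
  case (Cons n u)
  have "fword f (rev (map uminus (n # u))) (fword f (n # u) x) =
      fword f (rev (map uminus u)) (fx f (- n) (fx f n (fword f u x)))"
    by (simp add: fword_append)
  also have "\<dots> = x" using Cons by (simp only: fx_uminus)
  finally show ?case .
qed simp

lemma fast_basin_eq: "fast_basin N f A = (\<Union>u\<in>lists (Ineg N). K u)"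
proof (intro equalityI subsetI)
  fix x assume "x \<in> fast_basin N f A"
  then obtain u where u: "u \<in> lists (Ipos N)" "fword f u x \<in> A"
    by (auto simp: fast_basin_def hutch_funpow_singleton)
  then have "x \<in> K (rev (map uminus u))"
    using fword_inverse[OF lists_letters(1)[OF u(1)], of x] by (metis K_def imageI)
  then show "x \<in> (\<Union>u\<in>lists (Ineg N). K u)" using u(1) by (intro UN_I) auto
next
  fix x assume "x \<in> (\<Union>u\<in>lists (Ineg N). K u)"
  then obtain v where v: "v \<in> lists (Ineg N)" "x \<in> K v" by blast
  \<comment> \<open>The fast basin asks for at least one iteration, so a letter must exist in case
    \<open>v\<close> is empty.\<close>
  have "Ipos N \<noteq> {}"
  proof
    assume "Ipos N = {}"
    then have "(\<Union>n\<in>Ipos N. fx f n ` A) = {}" by simp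
    with A_eq A_nonempty show False by metis
  qed
  then obtain m where "m \<in> Ipos N" by blast
  \<comment> \<open>The appended negative letter makes the word nonempty and only enlarges
    \<open>K v\<close>.\<close>
  define u where "u = v @ [- m]"
  have u: "u \<in> lists (Ineg N)" using v(1) \<open>m \<in> Ipos N\<close> by (simp add: u_def)
  have "x \<in> K u" using K_mono[OF _ u, of v] v(2) by (auto simp: u_def)
  then obtain a where "a \<in> A" "x = fword f u a" by (auto simp: K_def)
  then have "fword f (rev (map uminus u)) x \<in> A"
    using fword_inverse[OF lists_letters(2)[OF u]] by simp
  moreover have "rev (map uminus u) \<in> lists (Ipos N)" using u by auto
  moreover have "length (rev (map uminus u)) \<ge> 1" by (simp add: u_def)
  ultimately show "x \<in> fast_basin N f A"
    unfolding fast_basin_def hutch_funpow_singleton by blast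
qed

lemma proj_L: "proj ` L = fast_basin N f A"
  unfolding fast_basin_eq
proof (intro equalityI subsetI)
  fix x assume "x \<in> proj ` L"
  then show "x \<in> (\<Union>u\<in>lists (Ineg N). K u)" using ipart_neg proj_in_K by blast
next
  fix x assume "x \<in> (\<Union>u\<in>lists (Ineg N). K u)"
  then obtain u where "u \<in> lists (Ineg N)" "x \<in> K u" by blast
  then show "x \<in> proj ` L" using K_obtain by (metis imageI)
qed

section \<open>Continuity and injectivity of the letter maps and of the coding\<close>

lemma continuous_map_sigma:
  assumes n: "n \<in> Ineg N"
  shows "continuous_map (words_hat_top N) (words_hat_top N) (sigma n)"
proof -
  have "continuous_map (words_hat_top N) (Metric_space.mtopology (words_hat N) dI) (sigma n)"
  proof (rule continuous_map_words_hatI[OF Metric_space_dI sigma_words_hat[OF n]])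
    fix \<iota> and e :: real assume "\<iota> \<in> words_hat N" "e > 0"
    obtain k where k: "(1/2) ^ k < e" using real_arch_pow_inv[OF \<open>e > 0\<close>, of "1/2"] by auto
    \<comment> \<open>Cancellation moves positions by one, and the first letters must agree for both
      words to fall under the same case; \<open>k + 2\<close> covers both.\<close>
    have "dI (sigma n \<iota>) (sigma n \<omega>) < e" if "\<forall>j<k + 2. \<iota> j = \<omega> j" for \<omega>
    proof -
      have "\<forall>j<k. sigma n \<iota> j = sigma n \<omega> j"
        using that by (auto simp: sigma_def shift_def split: nat.split)
      from dI_le[OF this] k show ?thesis by simp
    qed
    then show "\<exists>k. \<forall>\<omega>\<in>words_hat N. (\<forall>j<k. \<iota> j = \<omega> j) \<longrightarrow> dI (sigma n \<iota>) (sigma n \<omega>) < e" by blast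
  qed
  then show "continuous_map (words_hat_top N) (words_hat_top N) (sigma n)"
    by (simp add: words_hat_top_def)
qed

lemma inj_on_sigma: "n \<in> Ineg N \<Longrightarrow> inj_on (sigma n) (words_hat N)"
proof (rule inj_onI)
  fix \<iota> \<omega> assume n: "n \<in> Ineg N" and w: "\<iota> \<in> words_hat N" "\<omega> \<in> words_hat N"
    and eq: "sigma n \<iota> = sigma n \<omega>"
  \<comment> \<open>The first letter of the image reveals which case occurred: after a cancellation
    it cannot be \<open>n\<close>, the word being reduced.\<close>
  have *: "sigma n x 0 = n \<longleftrightarrow> x 0 \<noteq> - n" if "x \<in> words_hat N" for x
    using words_hat_reduced[OF that, of 0] by (auto simp: sigma_def shift_def)
  show "\<iota> = \<omega>"
  proof (cases "\<iota> 0 = - n")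
    case True
    then have "\<omega> 0 = - n" using eq * w by metis
    with True eq have "\<iota> (Suc i) = \<omega> (Suc i)" for i
      by (auto simp: sigma_def shift_def fun_eq_iff)
    moreover have "\<iota> 0 = \<omega> 0" using True \<open>\<omega> 0 = - n\<close> by simp
    ultimately have "\<iota> i = \<omega> i" for i by (cases i) auto
    then show ?thesis by blast
  next
    case False
    then have "\<omega> 0 \<noteq> - n" using eq * w by metis
    with False eq show ?thesis using shift_sigma by metis
  qed
qed

lemma inj_on_sigma_tilde: "n \<in> Ineg N \<Longrightarrow> inj_on (sigma_tilde N f A n) L"
proof (rule inj_onI)
  fix \<alpha> \<beta> assume n: "n \<in> Ineg N" and L: "\<alpha> \<in> L" "\<beta> \<in> L"
    and eq: "sigma_tilde N f A n \<alpha> = sigma_tilde N f A n \<beta>"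
  have "fx f n (proj \<alpha>) = fx f n (proj \<beta>)"
    using eq sigma_tilde_props(2)[OF n] L by metis
  then have p: "proj \<alpha> = proj \<beta>" using inj_fx[of n] n by (simp add: inj_eq)
  have "ipart \<alpha> = ipart \<beta>"
  proof (cases "fx f n (proj \<alpha>) \<in> A")
    case True
    \<comment> \<open>The inverse letter is positive and maps \<open>A\<close> into itself, so the
      common projection already lies in \<open>A\<close> and both integer parts are empty.\<close>
    then have "fx f (- n) (fx f n (proj \<alpha>)) \<in> A"
      using fx_pos_A[of "- n"] n by (simp only: uminus_Ipos image_subset_iff)
    then have "proj \<alpha> \<in> K []" using n fx_uminus(2)[of n "proj \<alpha>"] by simp
    then have "ipart \<alpha> = []" "ipart \<beta> = []"
      using proj_notin_K[OF L(1), of "[]"] proj_notin_K[OF L(2), of "[]"] p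
      by (metis Nil_prefix prefix_order.le_imp_less_or_eq)+
    then show ?thesis by simp
  next
    case False
    then show ?thesis
      using eq sigma_tilde_props(3)[OF n L(1)] sigma_tilde_props(3)[OF n L(2)] p by simp
  qed
  with p L show "\<alpha> = \<beta>" by (intro L_eqI)
qed

text \<open>For a positive word, all words sharing its first \<open>k\<close> letters are coded in
  one small image of \<open>A\<close>; leading negative letters only add continuous maps in
  front.\<close>

lemma coding_continuous:
  assumes "\<iota> \<in> words_hat N" "e > 0"
  shows "\<exists>k. \<forall>\<omega>\<in>words_hat N. (\<forall>j<k. \<iota> j = \<omega> j) \<longrightarrow> dist (cod \<iota>) (cod \<omega>) < e"
  using assms
proof (induction arbitrary: e rule: words_hat_induct)
  case (pos \<iota>)
  obtain x where x: "codes \<iota> x" "\<And>e. e > 0 \<Longrightarrow> \<forall>\<^sub>F k in sequentially. fword f (pre \<iota> k) ` A \<subseteq> ball x e"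
    using point_fibred_pos[OF pos(1)] by blast
  from x(1) have "x = cod \<iota>" using coding_eqI by metis
  \<comment> \<open>\<open>k \<ge> 1\<close> makes \<omega> begin with a positive letter, hence be
    positive throughout.\<close>
  obtain k where k: "fword f (pre \<iota> k) ` A \<subseteq> ball (cod \<iota>) e" "k \<ge> 1"
    using eventually_happens'[OF sequentially_bot eventually_conj[OF x(2)[OF pos(2)] eventually_ge_at_top[of 1]]]
      \<open>x = cod \<iota>\<close> by blast
  have "dist (cod \<iota>) (cod \<omega>) < e" if \<omega>: "\<omega> \<in> words_hat N" "\<forall>j<k. \<iota> j = \<omega> j" for \<omega>
  proof -
    have "\<omega> 0 \<in> Ipos N" using \<omega>(2) k(2) pos(1) unfolding words_pos_def by (metis (mono_tags) less_le_trans mem_Collect_eq zero_less_one)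
    then have "\<omega> \<in> words_pos N" using words_hat_pos[OF \<omega>(1), of 0] by simp
    then have "shift k \<omega> \<in> words_pos N" by (auto simp: words_pos_def shift_def)
    then have "cod \<omega> \<in> fword f (pre \<omega> k) ` A"
      using coding_pre[OF \<omega>(1), of k] coding_pos by blast
    also have "pre \<omega> k = pre \<iota> k" using \<omega>(2) by (simp add: pre_eq_iff)
    finally show ?thesis using k(1) by auto
  qed
  then show ?case by blast
next
  case (neg \<iota>)
  let ?g = "fx f (\<iota> 0)"
  have "continuous_on UNIV ?g" using neg(2) by (intro continuous_on_fx) auto
  then obtain \<delta> where \<delta>: "\<delta> > 0" "\<And>y. dist y (cod (shift (Suc 0) \<iota>)) < \<delta> \<Longrightarrow> dist (?g y) (?g (cod (shift (Suc 0) \<iota>))) < e"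
    using neg.prems unfolding continuous_on_iff by (metis UNIV_I)
  obtain k where k: "\<forall>\<omega>\<in>words_hat N. (\<forall>j<k. shift (Suc 0) \<iota> j = \<omega> j) \<longrightarrow> dist (cod (shift (Suc 0) \<iota>)) (cod \<omega>) < \<delta>"
    using neg(3)[OF \<delta>(1)] by blast
  have "dist (cod \<iota>) (cod \<omega>) < e" if \<omega>: "\<omega> \<in> words_hat N" "\<forall>j<Suc k. \<iota> j = \<omega> j" for \<omega>
  proof -
    have "\<forall>j<k. shift (Suc 0) \<iota> j = shift (Suc 0) \<omega> j" using \<omega>(2) by (simp add: shift_def)
    then have "dist (cod (shift (Suc 0) \<iota>)) (cod (shift (Suc 0) \<omega>)) < \<delta>"
      using k shift_words_hat[OF \<omega>(1)] by blast
    then have "dist (?g (cod (shift (Suc 0) \<iota>))) (?g (cod (shift (Suc 0) \<omega>))) < e"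
      using \<delta>(2) by (metis dist_commute)
    then show ?thesis using coding_Cons[OF neg(1)] coding_Cons[OF \<omega>(1)] \<omega>(2) by simp
  qed
  then show ?case by blast
qed

end

subsection \<open>The metric on the leaf space\<close>

text \<open>\<open>d\<close> is any metric inducing the given topology, so that \<open>dist\<close>
  and every competing metric \<open>d'\<close> are instances of the same results.\<close>

locale f_manifold = attractor_ifs f N A + X: Metric_space "UNIV :: 'a set" d
  for f :: "nat \<Rightarrow> 'a::complete_space \<Rightarrow> 'a" and N A and d :: "'a \<Rightarrow> 'a \<Rightarrow> real" +
  assumes mtopology_eq: "X.mtopology = euclidean"
begin

abbreviation d_L :: "(nat \<Rightarrow> int) set \<Rightarrow> (nat \<Rightarrow> int) set \<Rightarrow> real" where
  "d_L \<equiv> dL N f A d"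

abbreviation lcp :: "(nat \<Rightarrow> int) set \<Rightarrow> (nat \<Rightarrow> int) set \<Rightarrow> int list" where
  "lcp \<alpha> \<beta> \<equiv> longest_common_prefix (ipart \<alpha>) (ipart \<beta>)"

lemma lcp_neg: "\<alpha> \<in> L \<Longrightarrow> lcp \<alpha> \<beta> \<in> lists (Ineg N)"
  using ipart_neg[of \<alpha>] set_mono_prefix[OF longest_common_prefix_prefix1[of "ipart \<alpha>" "ipart \<beta>"]]
  by auto

lemma continuous_on_d: "continuous_on S (d a)"
proof -
  have "continuous_map euclidean euclidean (d a)"
    using continuous_on_mdist[of a "metric (UNIV, d)"] mtopology_eq
    by simp
  then show ?thesis using continuous_on_subset[of UNIV "d a" S] by simp
qed

lemma dL_set_eq:
  assumes "\<alpha> \<in> L"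
  shows "dL_set N f A d \<alpha> \<beta> = (\<lambda>z. d (proj \<alpha>) z + d z (proj \<beta>)) ` K (lcp \<alpha> \<beta>)"
  unfolding dL_set_def panicle2_def proj_panicle[OF lcp_neg[OF assms], symmetric] image_image ..

lemma dL_minimum:
  assumes "\<alpha> \<in> L"
  obtains z where "z \<in> K (lcp \<alpha> \<beta>)" "d_L \<alpha> \<beta> = d (proj \<alpha>) z + d z (proj \<beta>)"
    "\<And>z'. z' \<in> K (lcp \<alpha> \<beta>) \<Longrightarrow> d_L \<alpha> \<beta> \<le> d (proj \<alpha>) z' + d z' (proj \<beta>)"
proof -
  let ?h = "\<lambda>z. d (proj \<alpha>) z + d z (proj \<beta>)"
  have "continuous_on (K (lcp \<alpha> \<beta>)) (\<lambda>z. d (proj \<alpha>) z + d (proj \<beta>) z)"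
    by (intro continuous_on_add continuous_on_d)
  then have "continuous_on (K (lcp \<alpha> \<beta>)) ?h" by (simp only: X.commute[of "proj \<beta>"])
  then obtain z where z: "z \<in> K (lcp \<alpha> \<beta>)" "\<forall>z'\<in>K (lcp \<alpha> \<beta>). ?h z \<le> ?h z'"
    using continuous_attains_inf[OF compact_K[OF lcp_neg[OF assms]] K_nonempty] by blast
  then have "d_L \<alpha> \<beta> = ?h z"
    unfolding dL_def dL_set_eq[OF assms] by (intro cInf_eq_minimum) auto
  with z show ?thesis by (intro that) simp_all
qed

lemma dL_in_dL_set: "\<alpha> \<in> L \<Longrightarrow> d_L \<alpha> \<beta> \<in> dL_set N f A d \<alpha> \<beta>"
  unfolding dL_set_eq by (rule dL_minimum) auto

text \<open>Detours through \<open>K u\<close> are admissible for every common prefix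
  \<open>u\<close>, because \<open>K u\<close> is contained in \<open>K\<close> of the longest
  one.\<close>

lemma dL_le:
  assumes "\<alpha> \<in> L" "\<beta> \<in> L" "prefix u (ipart \<alpha>)" "prefix u (ipart \<beta>)" "z \<in> K u"
  shows "d_L \<alpha> \<beta> \<le> d (proj \<alpha>) z + d z (proj \<beta>)"
proof -
  have "K u \<subseteq> K (lcp \<alpha> \<beta>)"
    using assms by (intro K_mono lcp_neg longest_common_prefix_max_prefix)
  then show ?thesis using assms(5) dL_minimum[OF assms(1)] by (metis subsetD)
qed

lemma d_le_dL: "\<alpha> \<in> L \<Longrightarrow> d (proj \<alpha>) (proj \<beta>) \<le> d_L \<alpha> \<beta>"
  by (rule dL_minimum[of \<alpha> \<beta>]) (use X.triangle in auto)

lemma dL_commute: "d_L \<alpha> \<beta> = d_L \<beta> \<alpha>"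
  unfolding dL_def dL_set_def panicle2_def longest_common_prefix_commute[of "ipart \<alpha>"]
  by (simp add: X.commute add.commute)

text \<open>The detour point may be \<open>proj \<alpha>\<close> itself, and then the detour costs
  nothing extra.\<close>

lemma dL_eq_d_prefix:
  assumes "\<alpha> \<in> L" "\<beta> \<in> L" "prefix (ipart \<alpha>) (ipart \<beta>)"
  shows "d_L \<alpha> \<beta> = d (proj \<alpha>) (proj \<beta>)"
  using dL_le[OF assms(1,2) _ assms(3) proj_in_K[OF assms(1)]] d_le_dL[OF assms(1), of \<beta>]
  by (simp add: X.mdist_zero)

lemma dL_eq_d:
  assumes "\<alpha> \<in> L" "\<beta> \<in> L" "prefix (ipart \<alpha>) u" "prefix (ipart \<beta>) u"
  shows "d_L \<alpha> \<beta> = d (proj \<alpha>) (proj \<beta>)"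
  using prefix_same_cases[OF assms(3,4)]
proof
  assume "prefix (ipart \<beta>) (ipart \<alpha>)"
  from dL_eq_d_prefix[OF assms(2,1) this] show ?thesis by (simp only: dL_commute X.commute)
qed (rule dL_eq_d_prefix[OF assms(1,2)])

text \<open>Both \<open>lcp \<alpha> \<beta>\<close> and \<open>lcp \<beta> \<gamma>\<close> are
  prefixes of the integer part of \<beta>, hence comparable. The optimal detour point belonging to
  the shorter one is admissible for \<alpha> and \<gamma>.\<close>

lemma dL_triangle:
  assumes L: "\<alpha> \<in> L" "\<beta> \<in> L" "\<gamma> \<in> L"
  shows "d_L \<alpha> \<gamma> \<le> d_L \<alpha> \<beta> + d_L \<beta> \<gamma>"
proof -
  note pre = longest_common_prefix_prefix1 longest_common_prefix_prefix2
  have "prefix (lcp \<alpha> \<beta>) (lcp \<beta> \<gamma>) \<or> prefix (lcp \<beta> \<gamma>) (lcp \<alpha> \<beta>)"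
    by (rule prefix_same_cases[OF pre(2) pre(1)])
  then show ?thesis
  proof
    assume *: "prefix (lcp \<alpha> \<beta>) (lcp \<beta> \<gamma>)"
    obtain z where z: "z \<in> K (lcp \<alpha> \<beta>)" "d_L \<alpha> \<beta> = d (proj \<alpha>) z + d z (proj \<beta>)"
      using dL_minimum[OF L(1)] by metis
    have "d_L \<alpha> \<gamma> \<le> d (proj \<alpha>) z + d z (proj \<gamma>)"
      using prefix_order.trans[OF * pre(2)] z(1) by (intro dL_le[OF L(1,3) pre(1)])
    then show ?thesis
      using z(2) X.triangle[of z "proj \<beta>" "proj \<gamma>"] d_le_dL[OF L(2), of \<gamma>] by simp
  next
    assume *: "prefix (lcp \<beta> \<gamma>) (lcp \<alpha> \<beta>)"
    obtain z where z: "z \<in> K (lcp \<beta> \<gamma>)" "d_L \<beta> \<gamma> = d (proj \<beta>) z + d z (proj \<gamma>)"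
      using dL_minimum[OF L(2)] by metis
    have "d_L \<alpha> \<gamma> \<le> d (proj \<alpha>) z + d z (proj \<gamma>)"
      using prefix_order.trans[OF * pre(1)] z(1) by (intro dL_le[OF L(1,3) _ pre(2)])
    then show ?thesis
      using z(2) X.triangle[of "proj \<alpha>" "proj \<beta>" z] d_le_dL[OF L(1), of \<beta>] by simp
  qed
qed

text \<open>At distance zero both projections equal the detour point in \<open>K\<close> of the
  common prefix; minimality of the integer parts then makes that prefix equal to both.\<close>

lemma dL_eq_0_iff:
  assumes L: "\<alpha> \<in> L" "\<beta> \<in> L"
  shows "d_L \<alpha> \<beta> = 0 \<longleftrightarrow> \<alpha> = \<beta>"
proof
  assume 0: "d_L \<alpha> \<beta> = 0"
  obtain z where z: "z \<in> K (lcp \<alpha> \<beta>)" "d_L \<alpha> \<beta> = d (proj \<alpha>) z + d z (proj \<beta>)"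
    using dL_minimum[OF L(1)] by metis
  have "d (proj \<alpha>) z = 0" "d z (proj \<beta>) = 0"
    using 0 z(2) X.nonneg[of "proj \<alpha>" z] X.nonneg[of z "proj \<beta>"] by linarith+
  then have eq: "proj \<alpha> = z" "proj \<beta> = z" by simp_all
  then have "\<not> strict_prefix (lcp \<alpha> \<beta>) (ipart \<alpha>)" "\<not> strict_prefix (lcp \<alpha> \<beta>) (ipart \<beta>)"
    using z(1) proj_notin_K[OF L(1)] proj_notin_K[OF L(2)] by metis+
  then have "lcp \<alpha> \<beta> = ipart \<alpha>" "lcp \<alpha> \<beta> = ipart \<beta>"
    using longest_common_prefix_prefix1 longest_common_prefix_prefix2
    by (blast intro: prefix_order.le_neq_trans)+
  with eq L show "\<alpha> = \<beta>" by (intro L_eqI) simp_all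
next
  assume "\<alpha> = \<beta>"
  with L show "d_L \<alpha> \<beta> = 0" by (simp add: dL_eq_d_prefix)
qed

text \<open>\<open>Metric_space\<close> demands nonnegativity on the whole type: outside \<open>L\<close>, where \<open>Lint\<close>
  and \<open>pi_hat\<close> are junk, it holds because every panicle contains the leaf of the empty word.\<close>

lemma dL_nonneg: "0 \<le> d_L \<alpha> \<beta>"
proof -
  obtain \<gamma> where "\<gamma> \<in> leaf N f A []" using leaf_nonempty[of "[]"] by auto
  then have "\<gamma> \<in> panicle2 N f A \<alpha> \<beta>" by (simp add: panicle2_def panicle_eq leaf_def)
  then show ?thesis unfolding dL_def dL_set_def by (intro cInf_greatest) auto
qed

lemma Metric_space_dL: "Metric_space L d_L"
  by (intro Metric_space.intro dL_nonneg dL_commute dL_eq_0_iff dL_triangle)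

lemma topspace_Ltop: "topspace (Ltop N f A d) = L"
  unfolding Ltop_def by (rule Metric_space.topspace_mtopology[OF Metric_space_dL])

section \<open>Sheets, panicles and pathwise connectedness\<close>

lemma proj_sheet_isometry:
  assumes "\<alpha> \<in> sheet N f A \<theta>" "\<beta> \<in> sheet N f A \<theta>"
  shows "d (proj \<alpha>) (proj \<beta>) = d_L \<alpha> \<beta>"
proof -
  obtain j k where "\<alpha> \<in> L" "\<beta> \<in> L" "ipart \<alpha> = pre \<theta> j" "ipart \<beta> = pre \<theta> k"
    using assms by (auto simp: sheet_eq)
  then show ?thesis
    by (intro dL_eq_d[symmetric, of _ _ "pre \<theta> (max j k)"]) (simp_all add: prefix_pre_mono)
qed

text \<open>Any two integer parts in a panicle are comparable, so \<open>proj\<close> is an isometry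
  onto \<open>K u\<close>, which is homeomorphic to \<open>A\<close> through f_u.\<close>

lemma panicle_homeomorphic:
  assumes u: "u \<in> lists (Ineg N)"
  shows "subtopology (Ltop N f A d) (panicle N f A u) homeomorphic_space top_of_set A"
proof -
  interpret S: Submetric L d_L "panicle N f A u"
    using Metric_space_dL by (intro Submetric.intro Submetric_axioms.intro) (auto simp: panicle_eq)
  interpret KS: Submetric UNIV d "K u"
    using X.Metric_space_axioms by (intro Submetric.intro Submetric_axioms.intro) auto
  interpret SK: Metric_space12 "panicle N f A u" d_L "K u" d
    by (intro Metric_space12.intro S.sub.Metric_space_axioms KS.sub.Metric_space_axioms)
  have "homeomorphic_map S.sub.mtopology KS.sub.mtopology proj"
    by (rule SK.isometry_imp_homeomorphic_map[OF proj_panicle[OF u]])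
      (auto simp: panicle_eq dL_eq_d)
  then have 1: "subtopology (Ltop N f A d) (panicle N f A u) homeomorphic_space top_of_set (K u)"
    unfolding S.mtopology_submetric KS.mtopology_submetric mtopology_eq Ltop_def
    by (rule homeomorphic_map_imp_homeomorphic_space)
  \<comment> \<open>A continuous bijection from a compact space onto a Hausdorff space.\<close>
  have "homeomorphic_map (top_of_set A) (top_of_set (K u)) (fword f u)"
  proof (rule continuous_imp_homeomorphic_map)
    show "continuous_map (top_of_set A) (top_of_set (K u)) (fword f u)"
      using u by (simp add: K_def continuous_on_fword lists_letters(2) del: in_lists_conv_set)
    show "inj_on (fword f u) (topspace (top_of_set A))"
      using inj_fword[OF lists_letters(2)[OF u]] inj_on_subset by auto
  qed (simp_all add: K_def compact_A compact_space_subtopology Hausdorff_space_subtopology)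
  then have "top_of_set A homeomorphic_space top_of_set (K u)"
    by (rule homeomorphic_map_imp_homeomorphic_space)
  with 1 show ?thesis
    using homeomorphic_space_sym homeomorphic_space_trans by blast
qed

lemma path_connected_Ltop:
  assumes "path_connected A"
  shows "path_connected_space (Ltop N f A d)"
proof -
  \<comment> \<open>A base point in the leaf of the empty word, which all panicles share.\<close>
  obtain \<gamma> where \<gamma>: "\<gamma> \<in> L" "ipart \<gamma> = []"
    using leaf_nonempty[of "[]"] by (auto simp: leaf_def)
  have *: "path_component_of (Ltop N f A d) \<gamma> \<alpha>" if "\<alpha> \<in> L" for \<alpha>
  proof -
    have "path_connected_space (top_of_set A)"
      using assms by (metis path_connectedin_def path_connectedin_euclidean)
    then have "path_connected_space (subtopology (Ltop N f A d) (panicle N f A (ipart \<alpha>)))"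
      using homeomorphic_path_connected_space[OF panicle_homeomorphic[OF ipart_neg[OF that]]] by blast
    then have "path_connectedin (Ltop N f A d) (panicle N f A (ipart \<alpha>))"
      by (auto simp: path_connectedin_def topspace_Ltop panicle_eq)
    moreover have "\<gamma> \<in> panicle N f A (ipart \<alpha>)" "\<alpha> \<in> panicle N f A (ipart \<alpha>)"
      using \<gamma> that by (simp_all add: panicle_eq)
    ultimately show ?thesis unfolding path_component_of by blast
  qed
  then show ?thesis
    unfolding path_connected_space_iff_path_component topspace_Ltop
    by (meson path_component_of_sym path_component_of_trans)
qed

section \<open>Independence of the topology from the metric\<close>

text \<open>A short optimal detour for \<open>d\<close> keeps both \<open>z\<close> and
  \<open>proj \<beta>\<close> close to \<open>proj \<alpha>\<close>, so the same detour is short for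
  \<open>d'\<close>. Only continuity of the identity at \<open>proj \<alpha>\<close> is available,
  so the second leg is estimated through that point; hence three terms below
  \<open>e / 3\<close>.\<close>

lemma Ltop_continuous_id:
  assumes "f_manifold f N A d'"
  shows "continuous_map (Ltop N f A d) (Ltop N f A d') id"
proof -
  interpret Y: f_manifold f N A d' by fact
  have id: "continuous_map X.mtopology Y.X.mtopology id"
    by (simp add: mtopology_eq Y.mtopology_eq)
  show ?thesis
    unfolding Ltop_def Metric_space.metric_continuous_map[OF Metric_space_dL Y.Metric_space_dL]
  proof (intro conjI ballI allI impI)
    fix \<alpha> and e :: real assume \<alpha>: "\<alpha> \<in> L" and "e > 0"
    then have "e / 3 > 0" by simp
    then obtain \<delta> where "\<delta> > 0" and \<delta>: "\<And>y. d (proj \<alpha>) y < \<delta> \<Longrightarrow> d' (proj \<alpha>) y < e / 3"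
      using id unfolding X.metric_continuous_map[OF Y.X.Metric_space_axioms]
      by (metis UNIV_I id_apply)
    have "Y.d_L \<alpha> \<beta> < e" if \<beta>: "\<beta> \<in> L" "d_L \<alpha> \<beta> < \<delta>" for \<beta>
    proof -
      obtain z where z: "z \<in> K (lcp \<alpha> \<beta>)" "d_L \<alpha> \<beta> = d (proj \<alpha>) z + d z (proj \<beta>)"
        using dL_minimum[OF \<alpha>] by metis
      have "d (proj \<alpha>) z < \<delta>" using z(2) \<beta>(2) X.nonneg[of z "proj \<beta>"] by linarith
      moreover have "d (proj \<alpha>) (proj \<beta>) < \<delta>" using d_le_dL[OF \<alpha>, of \<beta>] \<beta>(2) by linarith
      ultimately have "d' (proj \<alpha>) z < e / 3" "d' (proj \<alpha>) (proj \<beta>) < e / 3" using \<delta> by blast+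
      moreover have "d' z (proj \<beta>) \<le> d' (proj \<alpha>) z + d' (proj \<alpha>) (proj \<beta>)"
        using Y.X.triangle[of z "proj \<alpha>" "proj \<beta>"] by (simp add: Y.X.commute)
      moreover have "Y.d_L \<alpha> \<beta> \<le> d' (proj \<alpha>) z + d' z (proj \<beta>)"
        using z(1) \<alpha> \<beta>(1) longest_common_prefix_prefix1 longest_common_prefix_prefix2
        by (intro Y.dL_le)
      ultimately show ?thesis by linarith
    qed
    with \<open>\<delta> > 0\<close> show "\<exists>\<delta>>0. \<forall>\<beta>. \<beta> \<in> L \<and> d_L \<alpha> \<beta> < \<delta> \<longrightarrow> Y.d_L (id \<alpha>) (id \<beta>) < e"
      by auto
  qed simp
qed

lemma Ltop_eq:
  assumes "f_manifold f N A d'"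
  shows "Ltop N f A d' = Ltop N f A d"
proof -
  interpret Y: f_manifold f N A d' by fact
  have "homeomorphic_maps (Ltop N f A d') (Ltop N f A d) id id"
    unfolding homeomorphic_maps_def
    using Ltop_continuous_id[OF assms] Y.Ltop_continuous_id[OF f_manifold_axioms] by simp
  then show ?thesis by (simp only: homeomorphic_maps_id)
qed

end

sublocale attractor_ifs \<subseteq> D: f_manifold f N A dist
  by unfold_locales (rule mtopology_is_euclidean)

context attractor_ifs
begin

section \<open>Continuity of the projections and of the induced letter maps\<close>

lemma continuous_map_cls: "continuous_map (words_hat_top N) (Ltop N f A dist) cls"
  unfolding Ltop_def
proof (rule continuous_map_words_hatI[OF D.Metric_space_dL cls_in_L])
  fix \<iota> and e :: real assume \<iota>: "\<iota> \<in> words_hat N" and "e > 0"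
  then obtain k where k: "\<forall>\<omega>\<in>words_hat N. (\<forall>j<k. \<iota> j = \<omega> j) \<longrightarrow> dist (cod \<iota>) (cod \<omega>) < e"
    using coding_continuous by blast
  obtain m where m: "\<iota> m \<in> Ipos N" using \<iota> by (auto simp: words_hat_def)
  \<comment> \<open>Agreement up to and including the positive letter at \<open>m\<close> makes both
    integer parts prefixes of one word, where the distance of classes is that of the coded
    points.\<close>
  have "dL N f A dist (cls \<iota>) (cls \<omega>) < e"
    if \<omega>: "\<omega> \<in> words_hat N" "\<forall>j<max k (Suc m). \<iota> j = \<omega> j" for \<omega>
  proof -
    have "pre \<iota> m = pre \<omega> m" "\<iota> m = \<omega> m" using \<omega>(2) by (auto simp: pre_eq_iff)
    then have "prefix (int_part N f A \<iota>) (pre \<iota> m)" "prefix (int_part N f A \<omega>) (pre \<iota> m)"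
      using int_part_prefix_pre \<iota> \<omega>(1) m by metis+
    then have "dL N f A dist (cls \<iota>) (cls \<omega>) = dist (cod \<iota>) (cod \<omega>)"
      using \<iota> \<omega>(1) D.dL_eq_d[of "cls \<iota>" "cls \<omega>"] by simp
    also have "\<dots> < e" using k \<omega> by simp
    finally show ?thesis .
  qed
  then show "\<exists>k. \<forall>\<omega>\<in>words_hat N. (\<forall>j<k. \<iota> j = \<omega> j) \<longrightarrow> dL N f A dist (cls \<iota>) (cls \<omega>) < e"
    by blast
qed

lemma continuous_map_proj:
  "continuous_map (Ltop N f A dist) (top_of_set (fast_basin N f A)) proj"
proof (rule continuous_map_into_subtopology)
  have "continuous_map (Ltop N f A dist) Met_TC.mtopology proj"
    unfolding Ltop_def Metric_space.metric_continuous_map[OF D.Metric_space_dL Met_TC.Metric_space_axioms]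
    using D.d_le_dL by (auto intro: le_less_trans)
  then show "continuous_map (Ltop N f A dist) euclidean proj" by simp
qed (use proj_L D.topspace_Ltop in auto)

text \<open>The image under \<open>fx f n\<close> of an optimal detour point serves the images,
  provided that \<open>n\<close> is prepended to both integer parts. Otherwise one of these becomes
  empty and the distance is simply that of the projections.\<close>

lemma continuous_map_sigma_tilde:
  assumes n: "n \<in> Ineg N"
  shows "continuous_map (Ltop N f A dist) (Ltop N f A dist) (sigma_tilde N f A n)"
  unfolding Ltop_def Metric_space.metric_continuous_map[OF D.Metric_space_dL D.Metric_space_dL]
proof (intro conjI ballI allI impI)
  show "sigma_tilde N f A n ` L \<subseteq> L" using sigma_tilde_props(1)[OF n] by blast
next
  let ?s = "sigma_tilde N f A n" and ?g = "fx f n"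
  note s = sigma_tilde_props[OF n]
  fix \<alpha> and e :: real assume \<alpha>: "\<alpha> \<in> L" and "e > 0"
  have "continuous_on UNIV ?g" using n by (intro continuous_on_fx) auto
  moreover have "e / 3 > 0" using \<open>e > 0\<close> by simp
  ultimately obtain \<delta> where "\<delta> > 0"
    and \<delta>: "\<And>y. dist y (proj \<alpha>) < \<delta> \<Longrightarrow> dist (?g y) (?g (proj \<alpha>)) < e / 3"
    unfolding continuous_on_iff by (metis UNIV_I)
  have "dL N f A dist (?s \<alpha>) (?s \<beta>) < e" if \<beta>: "\<beta> \<in> L" "dL N f A dist \<alpha> \<beta> < \<delta>" for \<beta>
  proof -
    obtain z where z: "z \<in> K (D.lcp \<alpha> \<beta>)" "dL N f A dist \<alpha> \<beta> = dist (proj \<alpha>) z + dist z (proj \<beta>)"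
      using D.dL_minimum[OF \<alpha>] by metis
    have "dist z (proj \<alpha>) < \<delta>"
      using z(2) \<beta>(2) zero_le_dist[of z "proj \<beta>"] dist_commute[of z "proj \<alpha>"] by linarith
    then have gz: "dist (?g z) (?g (proj \<alpha>)) < e / 3" by (rule \<delta>)
    have "dist (proj \<beta>) (proj \<alpha>) < \<delta>"
      using D.d_le_dL[OF \<alpha>, of \<beta>] \<beta>(2) dist_commute[of "proj \<beta>" "proj \<alpha>"] by linarith
    then have gy: "dist (?g (proj \<beta>)) (?g (proj \<alpha>)) < e / 3" by (rule \<delta>)
    show ?thesis
    proof (cases "?g (proj \<alpha>) \<in> A \<or> ?g (proj \<beta>) \<in> A")
      case True
      then have "ipart (?s \<alpha>) = [] \<or> ipart (?s \<beta>) = []"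
        using s(3) \<alpha> \<beta>(1) by auto
      then have "dL N f A dist (?s \<alpha>) (?s \<beta>) = dist (proj (?s \<alpha>)) (proj (?s \<beta>))"
        using D.dL_eq_d_prefix[OF s(1)[OF \<alpha>] s(1)[OF \<beta>(1)]]
          D.dL_eq_d_prefix[OF s(1)[OF \<beta>(1)] s(1)[OF \<alpha>]]
        by (metis Nil_prefix D.dL_commute dist_commute)
      also have "\<dots> = dist (?g (proj \<beta>)) (?g (proj \<alpha>))"
        using s(2) \<alpha> \<beta>(1) by (simp add: dist_commute)
      finally show ?thesis using gy \<open>e > 0\<close> by linarith
    next
      case False
      have "?g z \<in> K (n # D.lcp \<alpha> \<beta>)" using z(1) by (simp add: K_Cons)
      then have "dL N f A dist (?s \<alpha>) (?s \<beta>) \<le> dist (proj (?s \<alpha>)) (?g z) + dist (?g z) (proj (?s \<beta>))"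
        using False s \<alpha> \<beta>(1)
        by (intro D.dL_le) (simp_all add: longest_common_prefix_prefix1 longest_common_prefix_prefix2)
      also have "\<dots> = dist (?g z) (?g (proj \<alpha>)) + dist (?g z) (?g (proj \<beta>))"
        using s(2) \<alpha> \<beta>(1) by (simp add: dist_commute)
      \<comment> \<open>Continuity is known only at \<open>proj \<alpha>\<close>, so the estimate
        passes through its image.\<close>
      also have "dist (?g z) (?g (proj \<beta>)) \<le> dist (?g z) (?g (proj \<alpha>)) + dist (?g (proj \<beta>)) (?g (proj \<alpha>))"
        by (rule dist_triangle2)
      finally show ?thesis using gz gy by linarith
    qed
  qed
  with \<open>\<delta> > 0\<close> show "\<exists>\<delta>>0. \<forall>\<beta>. \<beta> \<in> L \<and> dL N f A dist \<alpha> \<beta> < \<delta> \<longrightarrow> dL N f A dist (?s \<alpha>) (?s \<beta>) < e"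
    by blast
qed

end

text \<open>Nonemptiness of a leaf carries the proviso on \<open>A\<close> because over a one-point
  attractor only the leaf of the empty word is inhabited; the partition is accordingly that into the
  nonempty leaves.\<close>

theorem theorem6p4:
  fixes f :: "nat \<Rightarrow> 'a::complete_space \<Rightarrow> 'a" and N :: nat and A :: "'a set"
  assumes "IFS N f" and "attractor N f A" and "point_fibred N f A"
  shows
    "((\<forall>\<alpha>\<in>Lspace N f A. \<forall>\<beta>\<in>Lspace N f A. dL N f A dist \<alpha> \<beta> \<in> dL_set N f A dist \<alpha> \<beta>)
        \<and> Metric_space (Lspace N f A) (dL N f A dist))
     \<and> (partition_on (Lspace N f A) (leaves N f A - {{}})
        \<and> (\<forall>\<theta>\<in>lists (Ineg N). \<theta> = [] \<or> \<not> is_singleton A \<longrightarrow> leaf N f A \<theta> \<noteq> {}))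
     \<and> pi_hat N f A ` Lspace N f A = fast_basin N f A
     \<and> (\<forall>\<theta>\<in>words_neg N.
          pi_hat N f A ` sheet N f A \<theta> = continuation f A (\<lambda>i. - \<theta> i)
        \<and> continuation f A (\<lambda>i. - \<theta> i) \<subseteq> fast_basin N f A
        \<and> (\<forall>\<alpha>\<in>sheet N f A \<theta>. \<forall>\<beta>\<in>sheet N f A \<theta>.
              dist (pi_hat N f A \<alpha>) (pi_hat N f A \<beta>) = dL N f A dist \<alpha> \<beta>))
     \<and> (\<forall>\<theta>\<in>lists (Ineg N).
          subtopology (Ltop N f A dist) (panicle N f A \<theta>) homeomorphic_space top_of_set A)
     \<and> (continuous_map (words_hat_top N) (Ltop N f A dist) (pi_tilde N f A)
        \<and> continuous_map (Ltop N f A dist) (top_of_set (fast_basin N f A)) (pi_hat N f A)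
        \<and> (\<forall>\<alpha>\<in>Lspace N f A. \<forall>\<beta>\<in>Lspace N f A.
              dist (pi_hat N f A \<alpha>) (pi_hat N f A \<beta>) \<le> dL N f A dist \<alpha> \<beta>))
     \<and> (path_connected A \<longrightarrow> path_connected_space (Ltop N f A dist))
     \<and> (\<forall>d'. Metric_space (UNIV :: 'a set) d' \<and> Metric_space.mtopology UNIV d' = euclidean \<longrightarrow>
          (\<forall>\<alpha>\<in>Lspace N f A. \<forall>\<beta>\<in>Lspace N f A. dL N f A d' \<alpha> \<beta> \<in> dL_set N f A d' \<alpha> \<beta>)
        \<and> Metric_space (Lspace N f A) (dL N f A d')
        \<and> Ltop N f A d' = Ltop N f A dist)
     \<and> (\<forall>n\<in>Ineg N.
          continuous_map (words_hat_top N) (words_hat_top N) (sigma n)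
        \<and> inj_on (sigma n) (words_hat N)
        \<and> continuous_map (Ltop N f A dist) (Ltop N f A dist) (sigma_tilde N f A n)
        \<and> inj_on (sigma_tilde N f A n) (Lspace N f A)
        \<and> (\<forall>\<iota>\<in>words_hat N.
              pi_tilde N f A (sigma n \<iota>) = sigma_tilde N f A n (pi_tilde N f A \<iota>))
        \<and> fx f n ` fast_basin N f A \<subseteq> fast_basin N f A
        \<and> (\<forall>\<alpha>\<in>Lspace N f A.
              pi_hat N f A (sigma_tilde N f A n \<alpha>) = fx f n (pi_hat N f A \<alpha>)))"
proof -
  interpret attractor_ifs f N A using assms by unfold_locales
  have manifold: "f_manifold f N A d'"
    if "Metric_space UNIV d'" "Metric_space.mtopology UNIV d' = euclidean" for d'
    using that by (intro f_manifold.intro f_manifold_axioms.intro attractor_ifs_axioms)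
  have sheet_sub: "continuation f A (\<lambda>i. - \<theta> i) \<subseteq> fast_basin N f A" if "\<theta> \<in> words_neg N" for \<theta>
    using proj_sheet[OF that] proj_L by (auto simp: sheet_eq)
  \<comment> \<open>The fast basin is the projection of \<open>L\<close>, so it inherits invariance
    from \<open>sigma_tilde\<close>.\<close>
  have fast_basin_sub: "fx f n ` fast_basin N f A \<subseteq> fast_basin N f A" if "n \<in> Ineg N" for n
    unfolding proj_L[symmetric] using sigma_tilde_props[OF that] by (force simp: image_iff)
  show ?thesis
    by (intro conjI ballI allI impI; (elim conjE)?)
      (simp_all add: D.dL_in_dL_set D.Metric_space_dL partition_leaves leaf_nonempty proj_L
        proj_sheet sheet_sub D.proj_sheet_isometry D.panicle_homeomorphic continuous_map_cls
        continuous_map_proj D.d_le_dL D.path_connected_Ltop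
        f_manifold.dL_in_dL_set[OF manifold] f_manifold.Metric_space_dL[OF manifold]
        D.Ltop_eq[OF manifold] continuous_map_sigma inj_on_sigma continuous_map_sigma_tilde
        inj_on_sigma_tilde fast_basin_sub sigma_tilde_props(2) del: in_lists_conv_set)
qed

end
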